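(* (a) The cyclic peak number $\operatorname{cpk}$ is cyclic shuffle-compatible. (b) The linear map on $\mathcal{A}_{\operatorname{cpk}}^{\mathrm{cyc}}$ defined by $$[\pi]_{\operatorname{cpk}}\mapsto \frac{\bigl(\operatorname{cpk}[\pi](1+t)^{2}+2(|\pi|-2\operatorname{cpk}[\pi])t\bigr)(4t)^{\operatorname{cpk}[\pi]}(1+t)^{|\pi|-2\operatorname{cpk}[\pi]-1}}{(1-t)^{|\pi|+1}}x^{|\pi|}$$ if $|\pi|\geq1$, and $[\pi]_{\operatorname{cpk}}\mapsto 1/(1-t)$ if $|\pi|=0$, is a $\mathbb{Q}$-algebra isomorphism from $\mathcal{A}_{\operatorname{cpk}}^{\mathrm{cyc}}$ to the span of $$\left\{ \frac{1}{1-t},\frac{tx}{(1-t)^{2}}\right\} \cup\left\{ \frac{(j(1+t)^{2}+2(n-2j)t)(4t)^{j}(1+t)^{n-2j-1}}{(1-t)^{n+1}}x^{n}\right\}_{n\geq2,\ 1\leq j\leq\lfloor n/2\rfloor},$$ a subalgebra of $\mathbb{Q}[[t*]][x]$. (c) Let $$w_{n,j}=j4^{j}\sum_{k=0}^{p-j}\left(\!\binom{n+1}{k}\!\right)\binom{n-2j+1}{p-j-k} x^n+2(n-2j)4^{j}\sum_{k=0}^{p-1-j}\left(\!\binom{n+1}{k}\!\right)\binom{n-2j-1}{p-j-k-1} x^n .$$ Then the linear map on $\mathcal{A}_{\operatorname{cpk}}^{\mathrm{cyc}}$ defined by $$[\pi]_{\operatorname{cpk}}\mapsto \begin{cases} w_{|\pi|,\operatorname{cpk}[\pi]},&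 \text{if }|\pi|\geq1,\\ 1, & \text{if }|\pi|=0,\end{cases}$$ is a $\mathbb{Q}$-algebra isomorphism from $\mathcal{A}_{\operatorname{cpk}}^{\mathrm{cyc}}$ to the span of $$\{1,\,w_{1,0}\}\cup\{w_{n,j}\}_{n\geq2,\ 1\leq j\leq\lfloor n/2\rfloor},$$ a subalgebra of $\mathbb{Q}[x]^{\mathbb{N}}$. (d) For all $n\geq2$, the $n$th homogeneous component of $\mathcal{A}_{\operatorname{cpk}}^{\mathrm{cyc}}$ has dimension $\lfloor n/2\rfloor$.
   Context: A (linear) permutation of length $n\ge 0$ is a sequence $\pi=\pi_1\cdots\pi_n$ of $n$ distinct positive integers; $|\pi|=n$; $\mathfrak{P}_n$ is the set of permutations of length $n$. Two permutations are disjoint if they have no letter in common, and have the same relative order if they have the same standardization (replace the $i$th smallest letter by $i$). For disjoint $\pi\in\mathfrak{P}_m$, $\sigma\in\mathfrak{P}_n$, $\operatorname{Sh}(\pi,\sigma)$ is the set of $\tau\in\mathfrak{P}_{m+n}$ having both $\pi$ and $\sigma$ as subsequences. The cyclic permutation $[\pi]$ is the set of all rotations of $\pi$; its length is $|\pi|$. A cyclic permutation statistic is a function $\operatorname{cst}$ on cyclic permutations with $\operatorname{cst}[\pi]=\operatorname{cst}[\sigma]$ whenever $\pi,\sigma$ have the same relative order. For disjoint $\pi,\sigma$, $\operatorname{cSh}([\pi],[\sigma])$ is the set of all $[\tau]$ with $\tau\in\operatorname{Sh}(\bar\pi,\bar\sigma)$ for some $\bar\pi\in[\pi]$, $\bar\sigma\in[\sigma]$.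 The statistic $\operatorname{cst}$ is cyclic shuffle-compatible if for disjoint $\pi,\sigma$ the multiset $\{\{\operatorname{cst}[\tau]:[\tau]\in\operatorname{cSh}([\pi],[\sigma])\}\}$ depends only on $\operatorname{cst}[\pi],\operatorname{cst}[\sigma],|\pi|,|\sigma|$. $[\pi]_{\operatorname{cst}}$ denotes the equivalence class of $[\pi]$ under: $[\pi]\sim[\sigma]$ iff $\operatorname{cst}[\pi]=\operatorname{cst}[\sigma]$ and $|\pi|=|\sigma|$. $\mathcal{A}^{\mathrm{cyc}}_{\operatorname{cst}}$ is the $\mathbb{Q}$-vector space with basis these classes; when $\operatorname{cst}$ is cyclic shuffle-compatible it is a $\mathbb{Q}$-algebra with multiplication $[\pi]_{\operatorname{cst}}[\sigma]_{\operatorname{cst}}=\sum_{[\tau]\in\operatorname{cSh}([\pi],[\sigma])}[\tau]_{\operatorname{cst}}$ for $\pi,\sigma$ disjoint. It is graded by length: the $n$th homogeneous component is spanned by the classes of cyclic permutations of length $n$. For $\pi\in\mathfrak{P}_n$, $\operatorname{cpk}[\pi]=\operatorname{cpk}\pi$ is the number of $i\in[n]$ with $\pi_{i-1}<\pi_i>\pi_{i+1}$, indices modulo $n$ (this is rotation-invariant). $\mathbb{Q}[[t*]]$ is the $\mathbb{Q}$-algebra of formal power series in $t$ under the Hadamard product $\bigl(\sum_n a_nt^n\bigr)*\bigl(\sum_n b_nt^n\bigr)=\sum_n a_nb_nt^n$; in $\mathbb{Q}[[t*]][x]$ the variable $x$ multiplies as usual. All products in the displayed formulas are ordinary products (of rational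 functions expanded in $t$); the Hadamard product is used only to multiply elements of the span. $\mathbb{N}$ is the set of non-negative integers and $\mathbb{Q}[x]^{\mathbb{N}}$ is the algebra of functions $\mathbb{N}\to\mathbb{Q}[x]$ (pointwise operations) in the variable $p$; an expression in $p$ denotes the corresponding function of $p$. $\left(\!\binom{n}{k}\!\right)$ is the number of $k$-element multisubsets of $[n]$. Empty sums are $0$, and terms with coefficient $0$ are read as $0$. *)

theory Defs
  imports
    "HOL-Library.Sublist"
    "HOL-Library.Multiset"
    "HOL-Library.Poly_Mapping"
    "HOL-Library.Function_Algebras"
    "HOL-Algebra.QuotRing"
    "HOL-Algebra.Module"
    "HOL-Computational_Algebra.Polynomial"
    "HOL-Computational_Algebra.Formal_Power_Series"
begin

section \<open>Linear and cyclic permutations\<close>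

definition lin_perm :: "nat list \<Rightarrow> bool" where
  "lin_perm \<pi> \<longleftrightarrow> distinct \<pi> \<and> (\<forall>a\<in>set \<pi>. 0 < a)"

definition disjoint_perms :: "nat list \<Rightarrow> nat list \<Rightarrow> bool" where
  "disjoint_perms \<pi> \<sigma> \<longleftrightarrow> set \<pi> \<inter> set \<sigma> = {}"

definition standardize :: "nat list \<Rightarrow> nat list" where
  "standardize \<pi> = map (\<lambda>a. card {b \<in> set \<pi>. b \<le> a}) \<pi>"

definition same_relative_order :: "nat list \<Rightarrow> nat list \<Rightarrow> bool" where
  "same_relative_order \<pi> \<sigma> \<longleftrightarrow> standardize \<pi> = standardize \<sigma>"

definition Sh :: "nat list \<Rightarrow> nat list \<Rightarrow> nat list set" where
  "Sh \<pi> \<sigma> = {\<tau>. lin_perm \<tau> \<and> length \<tau> = length \<pi> + length \<sigma> \<and> subseq \<pi> \<tau> \<and> subseq \<sigma> \<tau>}"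

definition cyc :: "nat list \<Rightarrow> nat list set" where
  "cyc \<pi> = {rotate k \<pi> |k. True}"

definition cSh :: "nat list set \<Rightarrow> nat list set \<Rightarrow> nat list set set" where
  "cSh P S = {cyc \<tau> |\<tau>. \<exists>\<pi>'\<in>P. \<exists>\<sigma>'\<in>S. \<tau> \<in> Sh \<pi>' \<sigma>'}"


section \<open>Cyclic permutation statistics\<close>

text \<open>A statistic is a function on all sets of lists; only its values on cyclic permutations matter.\<close>

definition cyc_statistic :: "(nat list set \<Rightarrow> 'a) \<Rightarrow> bool" where
  "cyc_statistic cst \<longleftrightarrow>
     (\<forall>\<pi> \<sigma>. lin_perm \<pi> \<and> lin_perm \<sigma> \<and> same_relative_order \<pi> \<sigma> \<longrightarrow> cst (cyc \<pi>) = cst (cyc \<sigma>))"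

definition cyc_shuffle_compatible :: "(nat list set \<Rightarrow> 'a) \<Rightarrow> bool" where
  "cyc_shuffle_compatible cst \<longleftrightarrow> cyc_statistic cst \<and>
     (\<forall>\<pi> \<sigma> \<pi>' \<sigma>'.
        lin_perm \<pi> \<and> lin_perm \<sigma> \<and> disjoint_perms \<pi> \<sigma> \<and>
        lin_perm \<pi>' \<and> lin_perm \<sigma>' \<and> disjoint_perms \<pi>' \<sigma>' \<and>
        cst (cyc \<pi>) = cst (cyc \<pi>') \<and> cst (cyc \<sigma>) = cst (cyc \<sigma>') \<and>
        length \<pi> = length \<pi>' \<and> length \<sigma> = length \<sigma>' \<longrightarrow>
        image_mset cst (mset_set (cSh (cyc \<pi>) (cyc \<sigma>))) =
        image_mset cst (mset_set (cSh (cyc \<pi>') (cyc \<sigma>'))))"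

text \<open>The next lemma shows that \<^const>\<open>mset_set\<close> above is never applied to an infinite set.\<close>

lemma finite_cSh: "finite (cSh (cyc \<pi>) (cyc \<sigma>))"
  if "lin_perm \<pi>" "lin_perm \<sigma>" "disjoint_perms \<pi> \<sigma>"
proof -
  let ?X = "{\<tau>. set \<tau> \<subseteq> set \<pi> \<union> set \<sigma> \<and> length \<tau> = length \<pi> + length \<sigma>}"
  have *: "\<tau> \<in> ?X" if a: "\<pi>' \<in> cyc \<pi>" "\<sigma>' \<in> cyc \<sigma>" "\<tau> \<in> Sh \<pi>' \<sigma>'" for \<pi>' \<sigma>' \<tau>
  proof -
    have [simp]: "set \<pi>' = set \<pi>" "set \<sigma>' = set \<sigma>" "length \<pi>' = length \<pi>" "length \<sigma>' = length \<sigma>"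
      using a by (auto simp: cyc_def)
    have sub: "set xs \<subseteq> set \<tau>" if "subseq xs \<tau>" for xs
      using that by (metis set_nths_subset subseq_conv_nths)
    have d: "distinct \<tau>" "length \<tau> = length \<pi> + length \<sigma>" "set \<pi> \<subseteq> set \<tau>" "set \<sigma> \<subseteq> set \<tau>"
      using a(3) sub[of \<pi>'] sub[of \<sigma>'] by (simp_all add: Sh_def lin_perm_def)
    have "card (set \<pi> \<union> set \<sigma>) = card (set \<tau>)"
      using that d \<open>disjoint_perms \<pi> \<sigma>\<close> \<open>lin_perm \<pi>\<close> \<open>lin_perm \<sigma>\<close>
      by (simp add: card_Un_disjoint disjoint_perms_def lin_perm_def distinct_card)
    then have "set \<pi> \<union> set \<sigma> = set \<tau>"
      using d by (intro card_subset_eq) auto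
    then show ?thesis using d by auto
  qed
  then have "cSh (cyc \<pi>) (cyc \<sigma>) \<subseteq> cyc ` ?X"
    unfolding cSh_def by blast
  moreover have "finite ?X" by (rule finite_lists_length_eq) simp
  ultimately show ?thesis by (meson finite_imageI finite_subset)
qed

text \<open>
  Positions are counted from 0. For a list of length 1 every position is its own neighbour, so
  there is no peak; for a list of length 2 both neighbours of a position are the other position.
\<close>

definition cpk_lin :: "nat list \<Rightarrow> nat" where
  "cpk_lin \<pi> = card {i. i < length \<pi> \<and>
     \<pi> ! ((i + length \<pi> - 1) mod length \<pi>) < \<pi> ! i \<and> \<pi> ! ((i + 1) mod length \<pi>) < \<pi> ! i}"

definition cpk :: "nat list set \<Rightarrow> nat" where
  "cpk P = cpk_lin (SOME \<pi>. \<pi> \<in> P)"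

lemma cpk_lin_rotate: "cpk_lin (rotate k \<pi>) = cpk_lin \<pi>"
proof -
  have le: "cpk_lin (rotate k \<pi>) \<le> cpk_lin \<pi>" for k \<pi>
  proof (cases "\<pi> = []")
    case False
    let ?n = "length \<pi>"
    have n: "?n > 0" using False by simp
    let ?f = "\<lambda>i. (k + i) mod ?n"
    have nth: "rotate k \<pi> ! i = \<pi> ! ?f i" if "i < ?n" for i
      using that by (simp add: nth_rotate)
    have pre: "(k + (i + ?n - 1) mod ?n) mod ?n = (?f i + ?n - 1) mod ?n" for i
    proof -
      have "?f i + ?n - 1 = ?f i + (?n - 1)" using n by linarith
      then have "(?f i + ?n - 1) mod ?n = (?f i + (?n - 1)) mod ?n" by (rule arg_cong)
      also have "\<dots> = (k + i + (?n - 1)) mod ?n" by (simp add: mod_add_left_eq)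
      also have "k + i + (?n - 1) = k + (i + ?n - 1)" using n by linarith
      finally show ?thesis by (simp add: mod_add_right_eq)
    qed
    have suc: "(k + (i + 1) mod ?n) mod ?n = (?f i + 1) mod ?n" for i
      by (simp add: mod_simps)
    show ?thesis unfolding cpk_lin_def length_rotate
    proof (rule card_inj_on_le[where f = ?f])
      show "inj_on ?f {i. i < ?n \<and> rotate k \<pi> ! ((i + ?n - 1) mod ?n) < rotate k \<pi> ! i
              \<and> rotate k \<pi> ! ((i + 1) mod ?n) < rotate k \<pi> ! i}"
      proof (rule inj_onI, clarify)
        have le: "x \<ge> y" if "?f x = ?f y" "y < ?n" for x y
        proof (rule ccontr)
          assume "\<not> x \<ge> y"
          then have "?n dvd (k + y) - (k + x)"
            using that mod_eq_dvd_iff_nat[of "k + x" "k + y" ?n] by simp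
          then show False using \<open>\<not> x \<ge> y\<close> \<open>y < ?n\<close> by (auto dest: dvd_imp_le)
        qed
        fix x y assume "?f x = ?f y" "x < ?n" "y < ?n"
        then show "x = y" using le[of x y] le[of y x] by simp
      qed
      show "?f ` {i. i < ?n \<and> rotate k \<pi> ! ((i + ?n - 1) mod ?n) < rotate k \<pi> ! i
              \<and> rotate k \<pi> ! ((i + 1) mod ?n) < rotate k \<pi> ! i}
            \<subseteq> {i. i < ?n \<and> \<pi> ! ((i + ?n - 1) mod ?n) < \<pi> ! i \<and> \<pi> ! ((i + 1) mod ?n) < \<pi> ! i}"
      proof clarify
        fix i assume i: "i < ?n" "rotate k \<pi> ! ((i + ?n - 1) mod ?n) < rotate k \<pi> ! i"
          "rotate k \<pi> ! ((i + 1) mod ?n) < rotate k \<pi> ! i"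
        have "(i + ?n - 1) mod ?n < ?n" "(i + 1) mod ?n < ?n" using n by simp_all
        then show "?f i < ?n \<and> \<pi> ! ((?f i + ?n - 1) mod ?n) < \<pi> ! ?f i
            \<and> \<pi> ! ((?f i + 1) mod ?n) < \<pi> ! ?f i"
          using i n by (simp only: nth pre suc) simp
      qed
    qed simp
  qed (simp add: cpk_lin_def)
  have "\<pi> = rotate (length \<pi> - k mod length \<pi>) (rotate k \<pi>)"
  proof (cases "\<pi> = []")
    case False
    let ?n = "length \<pi>"
    have "(?n - k mod ?n + k) mod ?n = (?n - k mod ?n + k mod ?n) mod ?n"
      by (simp only: mod_add_right_eq)
    also have "\<dots> = 0" using False by simp
    finally have "rotate (?n - k mod ?n + k) \<pi> = \<pi>"
      by (rule rotate_id)
    then show ?thesis by (simp add: rotate_rotate)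
  qed simp
  then show ?thesis by (metis le le_antisym)
qed

lemma cpk_cyc: "cpk (cyc \<pi>) = cpk_lin \<pi>"
proof -
  have "(SOME \<rho>. \<rho> \<in> cyc \<pi>) \<in> cyc \<pi>"
    by (rule someI[where x = "rotate 0 \<pi>"]) (unfold cyc_def, blast)
  then show ?thesis
    unfolding cpk_def by (auto simp: cyc_def cpk_lin_rotate)
qed


section \<open>Algebras over the rationals\<close>

definition rat_ring :: "rat ring" where
  "rat_ring = \<lparr>carrier = UNIV, monoid.mult = (*), one = 1, zero = 0, add = (+)\<rparr>"

definition algebra_iso :: "(rat, 'a) module \<Rightarrow> (rat, 'b) module \<Rightarrow> ('a \<Rightarrow> 'b) \<Rightarrow> bool" where
  "algebra_iso A B \<phi> \<longleftrightarrow>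
     algebra rat_ring A \<and> algebra rat_ring B \<and> \<phi> \<in> ring_iso A B \<and>
     (\<forall>c. \<forall>f\<in>carrier A. \<phi> (c \<odot>\<^bsub>A\<^esub> f) = c \<odot>\<^bsub>B\<^esub> \<phi> f)"

text \<open>
  A subset of an ambient commutative \<open>\<rat>\<close>-algebra with the operations and the unit of the ambient
  algebra: it is an \<^const>\<open>algebra\<close> over \<^const>\<open>rat_ring\<close> exactly if the subset is a (unital)
  subalgebra.
\<close>

definition restricted_algebra :: "(rat \<Rightarrow> 'a \<Rightarrow> 'a) \<Rightarrow> 'a set \<Rightarrow> (rat, 'a::comm_ring_1) module" where
  "restricted_algebra scale V =
     \<lparr>carrier = V, monoid.mult = (*), one = 1, zero = 0, add = (+), module.smult = scale\<rparr>"


section \<open>The cyclic shuffle algebra of a statistic\<close>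

definition cst_equiv :: "(nat list set \<Rightarrow> 'a) \<Rightarrow> (nat list set \<times> nat list set) set" where
  "cst_equiv cst = {(cyc \<pi>, cyc \<sigma>) |\<pi> \<sigma>. lin_perm \<pi> \<and> lin_perm \<sigma> \<and>
     cst (cyc \<pi>) = cst (cyc \<sigma>) \<and> length \<pi> = length \<sigma>}"

definition cst_class :: "(nat list set \<Rightarrow> 'a) \<Rightarrow> nat list set \<Rightarrow> nat list set set" where
  "cst_class cst P = cst_equiv cst `` {P}"

definition cst_classes :: "(nat list set \<Rightarrow> 'a) \<Rightarrow> nat list set set set" where
  "cst_classes cst = {cyc \<pi> |\<pi>. lin_perm \<pi>} // cst_equiv cst"

text \<open>
  Vectors are finitely supported rational functions on sets of cyclic permutations; those of the
  algebra are supported on equivalence classes.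
\<close>

type_synonym cyc_vec = "nat list set set \<Rightarrow>\<^sub>0 rat"

definition scale_vec :: "rat \<Rightarrow> ('k \<Rightarrow>\<^sub>0 rat) \<Rightarrow> ('k \<Rightarrow>\<^sub>0 rat)" where
  "scale_vec c f = Poly_Mapping.map ((*) c) f"

lemma lookup_scale_vec: "Poly_Mapping.lookup (scale_vec c f) k = c * Poly_Mapping.lookup f k"
  by (simp add: scale_vec_def Poly_Mapping.map.rep_eq when_def)

interpretation cyc_vec: vector_space scale_vec
  by standard (auto intro!: poly_mapping_eqI simp: lookup_scale_vec lookup_add algebra_simps)

definition cst_basis :: "(nat list set \<Rightarrow> 'a) \<Rightarrow> nat list set \<Rightarrow> cyc_vec" where
  "cst_basis cst P = Poly_Mapping.single (cst_class cst P) 1"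

text \<open>
  The product of two basis classes is computed from an arbitrary pair of disjoint representatives;
  \<open>cst_mult_basis\<close> below shows that the choice does not matter for a cyclic shuffle-compatible
  statistic.
\<close>

definition class_mult :: "(nat list set \<Rightarrow> 'a) \<Rightarrow> nat list set set \<Rightarrow> nat list set set \<Rightarrow> cyc_vec" where
  "class_mult cst C D =
     (case SOME (\<pi>, \<sigma>). lin_perm \<pi> \<and> lin_perm \<sigma> \<and> disjoint_perms \<pi> \<sigma> \<and>
                cst_class cst (cyc \<pi>) = C \<and> cst_class cst (cyc \<sigma>) = D
      of (\<pi>, \<sigma>) \<Rightarrow> \<Sum>T\<in>cSh (cyc \<pi>) (cyc \<sigma>). cst_basis cst T)"

definition cst_mult :: "(nat list set \<Rightarrow> 'a) \<Rightarrow> cyc_vec \<Rightarrow> cyc_vec \<Rightarrow> cyc_vec" where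
  "cst_mult cst f g =
     (\<Sum>C\<in>Poly_Mapping.keys f. \<Sum>D\<in>Poly_Mapping.keys g.
        scale_vec (Poly_Mapping.lookup f C * Poly_Mapping.lookup g D) (class_mult cst C D))"

definition cyc_algebra :: "(nat list set \<Rightarrow> 'a) \<Rightarrow> (rat, cyc_vec) module" where
  "cyc_algebra cst =
     \<lparr>carrier = {f. Poly_Mapping.keys f \<subseteq> cst_classes cst}, monoid.mult = cst_mult cst,
      one = cst_basis cst (cyc []), zero = 0, add = (+), module.smult = scale_vec\<rparr>"

definition homogeneous_component :: "(nat list set \<Rightarrow> 'a) \<Rightarrow> nat \<Rightarrow> cyc_vec set" where
  "homogeneous_component cst n =
     cyc_vec.span {cst_basis cst (cyc \<pi>) |\<pi>. lin_perm \<pi> \<and> length \<pi> = n}"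

lemma cyc_eq_length: "cyc \<pi> = cyc \<rho> \<Longrightarrow> length \<pi> = length \<rho>"
proof -
  assume "cyc \<pi> = cyc \<rho>"
  moreover have "rotate 0 \<pi> \<in> cyc \<pi>" unfolding cyc_def by blast
  ultimately show ?thesis by (auto simp: cyc_def)
qed

lemma cst_class_eq: "cst_class cst (cyc \<pi>) =
    {cyc \<rho> |\<rho>. lin_perm \<rho> \<and> length \<rho> = length \<pi> \<and> cst (cyc \<rho>) = cst (cyc \<pi>)}"
  if "lin_perm \<pi>"
proof -
  have "(cyc \<pi>, S) \<in> cst_equiv cst \<longleftrightarrow>
      (\<exists>\<rho>. S = cyc \<rho> \<and> lin_perm \<rho> \<and> length \<rho> = length \<pi> \<and> cst (cyc \<rho>) = cst (cyc \<pi>))" for S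
    unfolding cst_equiv_def using that by clarsimp (metis cyc_eq_length)
  then show ?thesis unfolding cst_class_def by auto
qed

lemma cst_mult_basis:
  assumes "cyc_shuffle_compatible cst" "lin_perm \<pi>" "lin_perm \<sigma>" "disjoint_perms \<pi> \<sigma>"
  shows "cst_mult cst (cst_basis cst (cyc \<pi>)) (cst_basis cst (cyc \<sigma>)) =
         (\<Sum>T\<in>cSh (cyc \<pi>) (cyc \<sigma>). cst_basis cst T)"
proof -
  let ?P = "\<lambda>(\<pi>', \<sigma>'). lin_perm \<pi>' \<and> lin_perm \<sigma>' \<and> disjoint_perms \<pi>' \<sigma>' \<and>
                cst_class cst (cyc \<pi>') = cst_class cst (cyc \<pi>) \<and>
                cst_class cst (cyc \<sigma>') = cst_class cst (cyc \<sigma>)"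
  obtain \<pi>' \<sigma>' where eps: "(SOME z. ?P z) = (\<pi>', \<sigma>')" by force
  have "?P (SOME z. ?P z)" by (rule someI[where x = "(\<pi>, \<sigma>)"]) (use assms in auto)
  then have r: "lin_perm \<pi>'" "lin_perm \<sigma>'" "disjoint_perms \<pi>' \<sigma>'"
      "cst_class cst (cyc \<pi>') = cst_class cst (cyc \<pi>)"
      "cst_class cst (cyc \<sigma>') = cst_class cst (cyc \<sigma>)"
    unfolding eps by auto
  have eq: "cst (cyc \<rho>) = cst (cyc \<rho>') \<and> length \<rho> = length \<rho>'"
    if "lin_perm \<rho>" "lin_perm \<rho>'" "cst_class cst (cyc \<rho>') = cst_class cst (cyc \<rho>)" for \<rho> \<rho>'
  proof -
    have "cyc \<rho> \<in> cst_class cst (cyc \<rho>')"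
      unfolding that(3) cst_class_eq[OF that(1)] using that(1) by blast
    then show ?thesis
      unfolding cst_class_eq[OF that(2)] by (auto dest: cyc_eq_length)
  qed
  have len: "length \<pi> = length \<pi>'" "length \<sigma> = length \<sigma>'"
    and c: "cst (cyc \<pi>) = cst (cyc \<pi>')" "cst (cyc \<sigma>) = cst (cyc \<sigma>')"
    using eq[of \<pi> \<pi>'] eq[of \<sigma> \<sigma>'] assms r by auto
  let ?F = "\<lambda>n v. Poly_Mapping.single
     {cyc \<rho> |\<rho>. lin_perm \<rho> \<and> length \<rho> = n \<and> cst (cyc \<rho>) = v} (1 :: rat)"
  have sum: "(\<Sum>T\<in>cSh (cyc \<alpha>) (cyc \<beta>). cst_basis cst T) =
      (\<Sum>v\<in>#image_mset cst (mset_set (cSh (cyc \<alpha>) (cyc \<beta>))). ?F (length \<alpha> + length \<beta>) v)"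
    for \<alpha> \<beta>
  proof -
    have "cst_basis cst T = ?F (length \<alpha> + length \<beta>) (cst T)" if T: "T \<in> cSh (cyc \<alpha>) (cyc \<beta>)" for T
    proof -
      obtain \<tau> \<alpha>' \<beta>' where t: "T = cyc \<tau>" "\<alpha>' \<in> cyc \<alpha>" "\<beta>' \<in> cyc \<beta>" "\<tau> \<in> Sh \<alpha>' \<beta>'"
        using T unfolding cSh_def by blast
      then have "length \<tau> = length \<alpha> + length \<beta>" "lin_perm \<tau>"
        by (auto simp: Sh_def cyc_def)
      then show ?thesis using t by (simp add: cst_basis_def cst_class_eq)
    qed
    then show ?thesis
      by (simp add: sum_unfold_sum_mset image_mset.compositionality comp_def cong: sum.cong)
  qed
  have "cst_mult cst (cst_basis cst (cyc \<pi>)) (cst_basis cst (cyc \<sigma>)) =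
      class_mult cst (cst_class cst (cyc \<pi>)) (cst_class cst (cyc \<sigma>))"
    by (simp add: cst_mult_def cst_basis_def)
  also have "\<dots> = (\<Sum>T\<in>cSh (cyc \<pi>') (cyc \<sigma>'). cst_basis cst T)"
    unfolding class_mult_def eps by simp
  also have "\<dots> = (\<Sum>T\<in>cSh (cyc \<pi>) (cyc \<sigma>). cst_basis cst T)"
  proof -
    have "image_mset cst (mset_set (cSh (cyc \<pi>) (cyc \<sigma>))) =
          image_mset cst (mset_set (cSh (cyc \<pi>') (cyc \<sigma>')))"
      using assms r len c unfolding cyc_shuffle_compatible_def by blast
    then show ?thesis unfolding sum len by simp
  qed
  finally show ?thesis .
qed


section \<open>Power series under the Hadamard product\<close>

text \<open>
  A copy of \<^typ>\<open>rat fps\<close> whose ring multiplication is coefficientwise, so that the library type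
  \<open>hfps poly\<close> is \<open>\<rat>[[t*]][x]\<close>. Ordinary products of series are formed in \<^typ>\<open>rat fps\<close>.
\<close>

typedef hfps = "UNIV :: rat fps set"
  morphisms fps_of_hfps hfps_of_fps by simp

setup_lifting type_definition_hfps

instantiation hfps :: comm_ring_1
begin

lift_definition zero_hfps :: hfps is "0" .
lift_definition one_hfps :: hfps is "Abs_fps (\<lambda>n. 1)" .
lift_definition plus_hfps :: "hfps \<Rightarrow> hfps \<Rightarrow> hfps" is "(+)" .
lift_definition minus_hfps :: "hfps \<Rightarrow> hfps \<Rightarrow> hfps" is "(-)" .
lift_definition uminus_hfps :: "hfps \<Rightarrow> hfps" is uminus .
lift_definition times_hfps :: "hfps \<Rightarrow> hfps \<Rightarrow> hfps" is
  "\<lambda>F G. Abs_fps (\<lambda>n. fps_nth F n * fps_nth G n)" .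

instance
  by standard (transfer; simp add: fps_eq_iff algebra_simps)+

end

lift_definition scale_hfps :: "rat \<Rightarrow> hfps \<Rightarrow> hfps" is "\<lambda>c F. fps_const c * F" .

definition scale_hpoly :: "rat \<Rightarrow> hfps poly \<Rightarrow> hfps poly" where
  "scale_hpoly c = map_poly (scale_hfps c)"

lemma coeff_scale_hpoly: "coeff (scale_hpoly c P) i = scale_hfps c (coeff P i)"
proof -
  have "scale_hfps c 0 = 0" by transfer simp
  then show ?thesis by (simp add: scale_hpoly_def coeff_map_poly)
qed

interpretation hpoly: vector_space scale_hpoly
proof -
  have "scale_hfps a (x + y) = scale_hfps a x + scale_hfps a y"
    "scale_hfps (a + b) x = scale_hfps a x + scale_hfps b x"
    "scale_hfps a (scale_hfps b x) = scale_hfps (a * b) x"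
    "scale_hfps 1 x = x" for a b x y
    by (transfer; simp add: fps_eq_iff algebra_simps)+
  then show "vector_space scale_hpoly"
    by unfold_locales (auto simp: poly_eq_iff coeff_scale_hpoly)
qed

text \<open>
  The exponent \<open>n - 2j - 1\<close> is \<open>-1\<close> if \<open>n = 2j\<close>; then \<open>powi\<close> yields the inverse power series of
  \<open>1 + t\<close>.
\<close>

definition cpk_fps :: "nat \<Rightarrow> nat \<Rightarrow> rat fps" where
  "cpk_fps n j =
     (of_nat j * (1 + fps_X) ^ 2 + 2 * (of_nat n - 2 * of_nat j) * fps_X) * (4 * fps_X) ^ j *
     (1 + fps_X) powi (int n - 2 * int j - 1) / (1 - fps_X) ^ (n + 1)"

definition cpk_series :: "nat \<Rightarrow> nat \<Rightarrow> hfps poly" where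
  "cpk_series n j = monom (hfps_of_fps (cpk_fps n j)) n"


section \<open>Polynomial-valued functions on the natural numbers\<close>

text \<open>
  The ring \<open>\<rat>[x]\<^sup>\<nat>\<close> is the type \<^typ>\<open>nat \<Rightarrow> rat poly\<close> with the pointwise operations.
\<close>

definition scale_pfun :: "rat \<Rightarrow> (nat \<Rightarrow> rat poly) \<Rightarrow> (nat \<Rightarrow> rat poly)" where
  "scale_pfun c f = (\<lambda>p. smult c (f p))"

interpretation pfun: vector_space scale_pfun
  by standard (auto simp: scale_pfun_def smult_add_left smult_add_right)

definition multichoose :: "nat \<Rightarrow> nat \<Rightarrow> nat" where
  "multichoose n k = card (multisets_of_size {1..n} k)"

text \<open>
  The index sets of the sums are \<open>0 \<le> k \<le> p - j\<close> and \<open>0 \<le> k \<le> p - 1 - j\<close>, with upper bounds in the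
  integers, so that they are empty if the bound is negative. For \<open>n \<ge> 2j\<close> the only truncated
  subtraction is \<open>n - 2j - 1\<close> for \<open>n = 2j\<close>, where the second sum has the coefficient 0.
\<close>

definition w :: "nat \<Rightarrow> nat \<Rightarrow> nat \<Rightarrow> rat poly" where
  "w n j = (\<lambda>p. monom
     (of_nat j * 4 ^ j *
        (\<Sum>k | k + j \<le> p. of_nat (multichoose (n + 1) k) * of_nat ((n - 2 * j + 1) choose (p - j - k)))
      + 2 * (of_nat n - 2 * of_nat j) * 4 ^ j *
        (\<Sum>k | k + 1 + j \<le> p.
           of_nat (multichoose (n + 1) k) * of_nat ((n - 2 * j - 1) choose (p - j - k - 1)))) n)"

end

theory Submission
  imports Defs
begin

text \<open>
  The cyclic shuffle algebra of \<^const>\<open>cpk\<close> is commutative and associative because it is an algebra of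
  counting functions. Let \<open>f\<close> assign to every letter of a finite alphabet a value in \<open>{0..<2p}\<close>, where
  \<open>2b\<close> stands for a negative and \<open>2b + 1\<close> for a positive entry of absolute value \<open>b + 1\<close>. Such a map
  sorts the alphabet into exactly one word: letters are ordered by value, and letters of equal value
  by their size, in a direction that depends on the sign. The map is called enriched for a cyclic
  permutation if this word is one of its rotations; this is the cyclic form of Stembridge's
  enriched \<open>P\<close>-partitions. A map on the union of two disjoint alphabets is a pair of maps, and
  its word restricts to the words of the two parts. Hence it is enriched for an element of
  \<open>cSh [\<pi>] [\<sigma>]\<close> iff its parts are enriched for \<open>[\<pi>]\<close> and \<open>[\<sigma>]\<close>, and the number of enriched maps turns
  cyclic shuffles into pointwise products, \<open>enriched_maps_mult\<close>.

  The generating function in \<open>p\<close> of these numbers depends on \<open>cpk\<close> and the length only. For a linear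
  permutation of length \<open>n\<close> with \<open>k\<close> interior peaks, reading one letter after the other gives
  \<open>2t (4t)^k (1 + t)^(n - 1 - 2k) / (1 - t)^(n + 1)\<close>, \<open>linear_enriched_fps\<close>. Of the \<open>n\<close> rotations of
  a cyclic permutation with \<open>c\<close> cyclic peaks, \<open>2c\<close> start or end with a peak and keep \<open>c - 1\<close>
  of them as interior peaks, and the other \<open>n - 2c\<close> keep all. Summing over the rotations yields the series
  \<^const>\<open>cpk_fps\<close>, \<open>enriched_maps_fps\<close>.

  For fixed \<open>n\<close> the series of the values \<open>j\<close> taken by \<open>cpk\<close> are linearly independent, since for
  \<open>n \<ge> 2\<close> the \<open>j\<close>-th one has order exactly \<open>j\<close>. Comparing coefficients in the product formula shows that the
  multiset of values on \<open>cSh [\<pi>] [\<sigma>]\<close> is determined, that is, shuffle-compatibility. The linear map that sends a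
  class to its series is injective and multiplicative, so the algebra laws of the cyclic
  shuffle algebra are inherited from the target, \<open>algebra_iso_extension\<close>. The power series and
  the functions of \<open>p\<close> are the same realization, since the value at \<open>p\<close> is the coefficient of \<open>t^p\<close>.
  The dimension is the number of values taken by \<open>cpk\<close>; the permutations \<open>zigzag\<close> show that every number
  from \<open>1\<close> to \<open>n div 2\<close> occurs.
\<close>

section \<open>Rotations and cyclic shuffles\<close>

lemma cyc_self: "\<pi> \<in> cyc \<pi>"
proof -
  have "rotate 0 \<pi> \<in> cyc \<pi>" unfolding cyc_def by blast
  then show ?thesis by simp
qed

lemma cyc_rotate: "cyc (rotate k \<pi>) = cyc \<pi>"
proof -
  let ?n = "length \<pi>"
  have "rotate j \<pi> = rotate (j + (?n - k mod ?n)) (rotate k \<pi>)" for j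
  proof (cases "\<pi> = []")
    case False
    then have n: "k mod ?n \<le> ?n" by simp
    have "(j + (?n - k mod ?n) + k) mod ?n = (j + (?n - k mod ?n) + k mod ?n) mod ?n"
      by (simp only: mod_add_right_eq)
    also have "\<dots> = j mod ?n" using n by simp
    finally show ?thesis
      by (simp add: rotate_rotate) (metis rotate_conv_mod)
  qed simp
  then show ?thesis
    unfolding cyc_def by (auto simp: rotate_rotate)
qed

lemma cyc_eqI: "\<tau> \<in> cyc \<pi> \<Longrightarrow> cyc \<tau> = cyc \<pi>"
  by (auto simp: cyc_def[of \<pi>] cyc_rotate)

lemma cyc_memD:
  assumes "\<tau> \<in> cyc \<pi>"
  shows "set \<tau> = set \<pi>" "length \<tau> = length \<pi>" "distinct \<tau> = distinct \<pi>"
  using assms by (auto simp: cyc_def)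

lemma filter_cyc:
  assumes "\<tau> \<in> cyc \<pi>"
  shows "filter P \<tau> \<in> cyc (filter P \<pi>)"
proof -
  have step: "filter P (rotate1 xs) \<in> cyc (filter P xs)" for xs :: "nat list"
  proof (cases xs)
    case (Cons x ys)
    have "rotate1 (filter P xs) \<in> cyc (filter P xs)" "filter P xs \<in> cyc (filter P xs)"
      by (auto simp: cyc_def intro: exI[of _ "Suc 0"] exI[of _ 0])
    then show ?thesis using Cons by (cases "P x") auto
  qed (simp add: cyc_self)
  have "filter P (rotate k \<pi>) \<in> cyc (filter P \<pi>)" for k
  proof (induction k)
    case (Suc k)
    then show ?case using step[of "rotate k \<pi>"] by (simp add: cyc_eqI)
  qed (simp add: cyc_self)
  then show ?thesis using assms by (auto simp: cyc_def[of \<pi>])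
qed

text \<open>
  Since letters do not repeat, a subsequence can be recovered from the word by its set of letters.
  This replaces the subsequence conditions in \<^const>\<open>Sh\<close> by restriction to an alphabet.
\<close>
lemma subseq_filter_set_eq:
  assumes "distinct \<tau>" "subseq xs \<tau>"
  shows "filter (\<lambda>a. a \<in> set xs) \<tau> = xs"
proof -
  have "set xs \<subseteq> set \<tau>" using assms(2) by (metis set_nths_subset subseq_conv_nths)
  moreover have "distinct xs" using assms by (metis distinct_nthsI subseq_conv_nths)
  ultimately have "{a \<in> set \<tau>. a \<in> set xs} = set xs" "distinct xs" by auto
  then have "length xs = length (filter (\<lambda>a. a \<in> set xs) \<tau>)"
    using assms(1) distinct_card[of xs] distinct_card[of "filter (\<lambda>a. a \<in> set xs) \<tau>"] by simp
  moreover have "subseq (filter (\<lambda>a. a \<in> set xs) xs) (filter (\<lambda>a. a \<in> set xs) \<tau>)"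
    using assms(2) by (rule subseq_filter)
  ultimately show ?thesis using subseq_same_length by fastforce
qed

text \<open>
  A cyclic shuffle is controlled by restriction: rotating a word rotates its restrictions to the two
  alphabets, so every rotation of \<open>\<tau>\<close> restricts to rotations of \<open>\<pi>\<close> and \<open>\<sigma>\<close>.
\<close>
lemma cSh_E:
  assumes "T \<in> cSh (cyc \<pi>) (cyc \<sigma>)" "lin_perm \<pi>" "lin_perm \<sigma>" "disjoint_perms \<pi> \<sigma>"
  obtains \<tau> where "T = cyc \<tau>" "lin_perm \<tau>" "set \<tau> = set \<pi> \<union> set \<sigma>"
    "length \<tau> = length \<pi> + length \<sigma>"
    "filter (\<lambda>a. a \<in> set \<pi>) \<tau> \<in> cyc \<pi>" "filter (\<lambda>a. a \<in> set \<sigma>) \<tau> \<in> cyc \<sigma>"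
proof -
  obtain \<tau> \<pi>' \<sigma>' where t: "T = cyc \<tau>" "\<pi>' \<in> cyc \<pi>" "\<sigma>' \<in> cyc \<sigma>" "\<tau> \<in> Sh \<pi>' \<sigma>'"
    using assms(1) unfolding cSh_def by blast
  note pi = cyc_memD[OF t(2)] and si = cyc_memD[OF t(3)]
  have d: "lin_perm \<tau>" "distinct \<tau>" "length \<tau> = length \<pi> + length \<sigma>"
    "subseq \<pi>' \<tau>" "subseq \<sigma>' \<tau>"
    using t(4) pi si by (simp_all add: Sh_def lin_perm_def)
  have f: "filter (\<lambda>a. a \<in> set \<pi>) \<tau> = \<pi>'" "filter (\<lambda>a. a \<in> set \<sigma>) \<tau> = \<sigma>'"
    using subseq_filter_set_eq[OF d(2) d(4)] subseq_filter_set_eq[OF d(2) d(5)]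
    by (simp_all add: pi si)
  have sub: "set \<pi> \<subseteq> set \<tau>" "set \<sigma> \<subseteq> set \<tau>"
    using f pi(1) si(1) by (metis filter_is_subset)+
  have "card (set \<pi> \<union> set \<sigma>) = card (set \<tau>)"
    using assms d by (simp add: card_Un_disjoint disjoint_perms_def lin_perm_def distinct_card)
  then have "set \<tau> = set \<pi> \<union> set \<sigma>" using sub card_subset_eq[of "set \<tau>" "set \<pi> \<union> set \<sigma>"] by auto
  then show ?thesis using that[OF t(1)] d f t(2,3) by simp
qed

section \<open>Enriched maps\<close>

lemma sorted_wrt_unique:
  assumes "asymp R" "sorted_wrt R xs" "sorted_wrt R ys" "set xs = set ys"
  shows "xs = ys"
  using assms(2-4)
proof (induction xs arbitrary: ys)
  case (Cons x xs)
  then obtain y zs where ys: "ys = y # zs" by (cases ys) auto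
  have "x = y"
  proof (rule ccontr)
    assume "x \<noteq> y"
    then have "x \<in> set zs" "y \<in> set xs" using Cons.prems ys by auto
    then have "R x y" "R y x" using Cons.prems ys by auto
    then show False using \<open>asymp R\<close> by (meson asympD)
  qed
  moreover have "x \<notin> set xs" "y \<notin> set zs"
    using Cons.prems ys \<open>asymp R\<close> by (auto dest: asympD)
  then have "set xs = set zs" using Cons.prems(3) ys \<open>x = y\<close> by auto
  then have "xs = zs" using Cons.IH Cons.prems ys by simp
  ultimately show ?case using ys by simp
qed simp

lemma sorted_wrt_exists:
  assumes "transp R" "totalp R" "finite A"
  shows "\<exists>xs. set xs = A \<and> sorted_wrt R xs"
  using assms(3)
proof (induction A)
  case (insert x A)
  then obtain xs where xs: "set xs = A" "sorted_wrt R xs" by blast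
  let ?l = "filter (\<lambda>y. R y x) xs" and ?r = "filter (\<lambda>y. R x y) xs"
  have "set (?l @ x # ?r) = insert x A"
    using xs(1) insert.hyps(2) \<open>totalp R\<close> by (auto dest: totalpD)
  moreover have "sorted_wrt R (?l @ x # ?r)"
    using xs(2) \<open>transp R\<close> by (auto simp: sorted_wrt_append sorted_wrt_filter dest: transpD)
  ultimately show ?case by blast
qed simp

text \<open>
  The order in which a map sorts the letters: by decreasing value, letters of the same even value
  increasingly and letters of the same odd value decreasingly. Read backwards, these are the words
  that are weakly increasing for the order \<open>-1 < 1 < -2 < 2 < \<dots>\<close> with descents at repeated negative
  and ascents at repeated positive entries. Values decrease along the word so that its
  head carries the largest value, which makes recursion on lists possible without a bound
  on the values.
\<close>
definition before :: "(nat \<Rightarrow> nat) \<Rightarrow> nat \<Rightarrow> nat \<Rightarrow> bool" where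
  "before f a b \<longleftrightarrow> f b < f a \<or> f a = f b \<and> (if even (f a) then a < b else b < a)"

lemma asymp_before: "asymp (before f)"
  by (rule asympI) (metis before_def less_asym)

lemma transp_before: "transp (before f)"
  by (rule transpI) (smt (verit) before_def less_trans)

lemma totalp_before: "totalp (before f)"
  by (rule totalpI) (metis before_def linorder_neqE_nat)
lemma sorted_before_unique:
  "sorted_wrt (before f) xs \<Longrightarrow> sorted_wrt (before f) ys \<Longrightarrow> set xs = set ys \<Longrightarrow> xs = ys"
  by (rule sorted_wrt_unique[OF asymp_before])

lemma sorted_before_distinct: "sorted_wrt (before f) xs \<Longrightarrow> distinct xs"
  by (induction xs) (auto simp: before_def)

lemma sorted_before_cong:
  "(\<And>a. a \<in> set xs \<Longrightarrow> f a = g a) \<Longrightarrow> sorted_wrt (before f) xs \<longleftrightarrow> sorted_wrt (before g) xs"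
  by (intro iffI; rule sorted_wrt_mono_rel, simp_all add: before_def)

text \<open>
  The argument is a cyclic permutation; extensional functions make the set finite and let a map on a
  union of alphabets be identified with the pair of its restrictions.
\<close>
definition enriched_maps :: "nat \<Rightarrow> nat list set \<Rightarrow> (nat \<Rightarrow> nat) set" where
  "enriched_maps q T =
     {f \<in> (\<Union>\<tau>\<in>T. set \<tau>) \<rightarrow>\<^sub>E {..<q}. \<exists>\<tau>\<in>T. sorted_wrt (before f) \<tau>}"

lemma enriched_maps_cyc:
  "enriched_maps q (cyc \<pi>) = {f \<in> set \<pi> \<rightarrow>\<^sub>E {..<q}. \<exists>\<tau>\<in>cyc \<pi>. sorted_wrt (before f) \<tau>}"
proof -
  have "(\<Union>\<tau>\<in>cyc \<pi>. set \<tau>) = set \<pi>"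
    by (rule equalityI) (auto dest: cyc_memD(1) intro: UN_upper[OF cyc_self, THEN subsetD])
  then show ?thesis by (simp add: enriched_maps_def)
qed

lemma finite_enriched_maps: "finite (enriched_maps q (cyc \<pi>))"
  unfolding enriched_maps_cyc by (rule finite_subset[of _ "set \<pi> \<rightarrow>\<^sub>E {..<q}"]) (auto intro: finite_PiE)

text \<open>
  The word sorted by \<open>h\<close> restricts on each alphabet to the word sorted by the restriction of \<open>h\<close>.
  If it is a rotation of a cyclic shuffle, then the restrictions are rotations of
  \<open>\<pi>\<close> and \<open>\<sigma>\<close>. Conversely, if they are, then the sorted word itself is a
  shuffle of these rotations.
\<close>
lemma enriched_maps_split:
  assumes "lin_perm \<pi>" "lin_perm \<sigma>" "disjoint_perms \<pi> \<sigma>"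
  shows "bij_betw (\<lambda>h. (restrict h (set \<pi>), restrict h (set \<sigma>)))
           (\<Union>T\<in>cSh (cyc \<pi>) (cyc \<sigma>). enriched_maps q T)
           (enriched_maps q (cyc \<pi>) \<times> enriched_maps q (cyc \<sigma>))"
proof (rule bij_betw_byWitness[where f' = "\<lambda>(f, g) a. if a \<in> set \<pi> then f a else g a"])
  let ?A = "set \<pi>" and ?B = "set \<sigma>"
  let ?U = "\<Union>T\<in>cSh (cyc \<pi>) (cyc \<sigma>). enriched_maps q T"
  have disj: "?A \<inter> ?B = {}" using assms(3) by (simp add: disjoint_perms_def)
  have U: "h \<in> (?A \<union> ?B \<rightarrow>\<^sub>E {..<q}) \<and> restrict h ?A \<in> enriched_maps q (cyc \<pi>)
      \<and> restrict h ?B \<in> enriched_maps q (cyc \<sigma>)" if hU: "h \<in> ?U" for h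
  proof -
    obtain T where T: "T \<in> cSh (cyc \<pi>) (cyc \<sigma>)" "h \<in> enriched_maps q T" using hU by (rule UN_E)
    obtain \<tau> where t: "T = cyc \<tau>" "set \<tau> = ?A \<union> ?B"
      "filter (\<lambda>a. a \<in> ?A) \<tau> \<in> cyc \<pi>" "filter (\<lambda>a. a \<in> ?B) \<tau> \<in> cyc \<sigma>"
      using cSh_E[OF T(1) assms] by metis
    obtain \<tau>' where t': "\<tau>' \<in> cyc \<tau>" "sorted_wrt (before h) \<tau>'"
      and h: "h \<in> ?A \<union> ?B \<rightarrow>\<^sub>E {..<q}"
      using T(2) t(1,2) by (auto simp: enriched_maps_cyc)
    have part: "restrict h (set \<rho>) \<in> enriched_maps q (cyc \<rho>)"
      if r: "filter (\<lambda>a. a \<in> set \<rho>) \<tau> \<in> cyc \<rho>" "set \<rho> \<subseteq> ?A \<union> ?B" for \<rho>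
    proof -
      let ?f = "filter (\<lambda>a. a \<in> set \<rho>) \<tau>'"
      have "?f \<in> cyc \<rho>" using filter_cyc[OF t'(1)] cyc_eqI[OF r(1)] by blast
      moreover have "sorted_wrt (before (restrict h (set \<rho>))) ?f"
        using sorted_wrt_filter[OF t'(2), of "\<lambda>a. a \<in> set \<rho>"]
          sorted_before_cong[of ?f "restrict h (set \<rho>)" h] by auto
      moreover have "restrict h (set \<rho>) \<in> set \<rho> \<rightarrow>\<^sub>E {..<q}"
        using h r(2) by (auto simp: PiE_iff)
      ultimately show ?thesis unfolding enriched_maps_cyc by blast
    qed
    show ?thesis using h part[OF t(3)] part[OF t(4)] by blast
  qed
  show "\<forall>h\<in>?U. (\<lambda>(f, g) a. if a \<in> ?A then f a else g a) (restrict h ?A, restrict h ?B) = h"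
    using U by (fastforce simp: fun_eq_iff PiE_iff extensional_def)
  have ext: "f \<in> set \<rho> \<rightarrow>\<^sub>E {..<q}" if "f \<in> enriched_maps q (cyc \<rho>)" for f \<rho>
    using that by (simp add: enriched_maps_cyc)
  show "\<forall>fg\<in>enriched_maps q (cyc \<pi>) \<times> enriched_maps q (cyc \<sigma>).
      (restrict ((\<lambda>(f, g) a. if a \<in> ?A then f a else g a) fg) ?A,
       restrict ((\<lambda>(f, g) a. if a \<in> ?A then f a else g a) fg) ?B) = fg"
    using disj by (auto simp: fun_eq_iff restrict_def dest!: ext)
  show "(\<lambda>h. (restrict h ?A, restrict h ?B)) ` ?U \<subseteq> enriched_maps q (cyc \<pi>) \<times> enriched_maps q (cyc \<sigma>)"
    using U by auto
  show "(\<lambda>(f, g) a. if a \<in> ?A then f a else g a) ` (enriched_maps q (cyc \<pi>) \<times> enriched_maps q (cyc \<sigma>)) \<subseteq> ?U"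
  proof clarify
    fix f g assume fg: "f \<in> enriched_maps q (cyc \<pi>)" "g \<in> enriched_maps q (cyc \<sigma>)"
    define h where "h = (\<lambda>a. if a \<in> ?A then f a else g a)"
    obtain \<pi>' \<sigma>' where p: "\<pi>' \<in> cyc \<pi>" "sorted_wrt (before f) \<pi>'"
      and s: "\<sigma>' \<in> cyc \<sigma>" "sorted_wrt (before g) \<sigma>'"
      using fg by (auto simp: enriched_maps_cyc)
    note pi = cyc_memD[OF p(1)] and si = cyc_memD[OF s(1)]
    have "sorted_wrt (before h) \<pi>'"
      using p(2) sorted_before_cong[of \<pi>' f h] by (simp add: h_def pi)
    moreover have "g a = h a" if "a \<in> ?B" for a using that disj by (auto simp: h_def)
    then have "sorted_wrt (before h) \<sigma>'"
      using s(2) sorted_before_cong[of \<sigma>' g h] by (simp add: si)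
    moreover obtain \<tau> where t: "set \<tau> = ?A \<union> ?B" "sorted_wrt (before h) \<tau>"
      using sorted_wrt_exists[OF transp_before totalp_before, of "?A \<union> ?B" h] by auto
    \<comment> \<open>Sorting is unique, so the part of the sorted word on either alphabet is the given word.\<close>
    ultimately have f: "filter (\<lambda>a. a \<in> ?A) \<tau> = \<pi>'" "filter (\<lambda>a. a \<in> ?B) \<tau> = \<sigma>'"
      by (auto simp: pi(1) si(1) intro!: sorted_before_unique[OF sorted_wrt_filter])
    have "distinct \<tau>" using t(2) by (rule sorted_before_distinct)
    then have "length \<tau> = length \<pi>' + length \<sigma>'"
      using t(1) disj assms(1,2) distinct_card[OF \<open>distinct \<tau>\<close>] distinct_card[of \<pi>] distinct_card[of \<sigma>]
      by (simp add: card_Un_disjoint lin_perm_def pi(2) si(2))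
    moreover have "lin_perm \<tau>" using \<open>distinct \<tau>\<close> t(1) assms by (auto simp: lin_perm_def)
    moreover have "subseq \<pi>' \<tau>" "subseq \<sigma>' \<tau>" using f by (metis subseq_filter_left)+
    ultimately have "cyc \<tau> \<in> cSh (cyc \<pi>) (cyc \<sigma>)"
      unfolding cSh_def Sh_def using p(1) s(1) by auto
    moreover have "h \<in> ?A \<union> ?B \<rightarrow>\<^sub>E {..<q}"
      using ext[OF fg(1)] ext[OF fg(2)] by (auto simp: h_def PiE_iff extensional_def)
    then have "h \<in> enriched_maps q (cyc \<tau>)"
      using t cyc_self unfolding enriched_maps_cyc by auto
    ultimately show "(\<lambda>a. if a \<in> ?A then f a else g a) \<in> ?U" unfolding h_def by blast
  qed
qed

text \<open>
  Different cyclic permutations of the same letters have disjoint sets of enriched maps, because the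
  sorted word determines the cyclic permutation. So the union in the previous
  bijection is counted by a sum.
\<close>
theorem enriched_maps_mult:
  assumes "lin_perm \<pi>" "lin_perm \<sigma>" "disjoint_perms \<pi> \<sigma>"
  shows "card (enriched_maps q (cyc \<pi>)) * card (enriched_maps q (cyc \<sigma>)) =
         (\<Sum>T\<in>cSh (cyc \<pi>) (cyc \<sigma>). card (enriched_maps q T))"
proof -
  let ?S = "cSh (cyc \<pi>) (cyc \<sigma>)"
  have "card (\<Union>T\<in>?S. enriched_maps q T) = (\<Sum>T\<in>?S. card (enriched_maps q T))"
  proof (rule card_UN_disjoint)
    show "finite ?S" by (rule finite_cSh[OF assms])
    show "\<forall>T\<in>?S. finite (enriched_maps q T)"
      by (metis cSh_E[OF _ assms] finite_enriched_maps)
    show "\<forall>T\<in>?S. \<forall>T'\<in>?S. T \<noteq> T' \<longrightarrow> enriched_maps q T \<inter> enriched_maps q T' = {}"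
    proof (intro ballI impI)
      fix T T' assume T: "T \<in> ?S" "T' \<in> ?S" "T \<noteq> T'"
      obtain \<tau> where t: "T = cyc \<tau>" "set \<tau> = set \<pi> \<union> set \<sigma>" using cSh_E[OF T(1) assms] by metis
      obtain \<tau>' where t': "T' = cyc \<tau>'" "set \<tau>' = set \<pi> \<union> set \<sigma>" using cSh_E[OF T(2) assms] by metis
      have "False" if h: "h \<in> enriched_maps q T" "h \<in> enriched_maps q T'" for h
      proof -
        obtain a b where ab: "a \<in> cyc \<tau>" "sorted_wrt (before h) a" "b \<in> cyc \<tau>'" "sorted_wrt (before h) b"
          using h t t' by (auto simp: enriched_maps_cyc)
        have "set a = set b" using cyc_memD(1)[OF ab(1)] cyc_memD(1)[OF ab(3)] t t' by simp
        then have "a = b" using sorted_before_unique ab by blast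
        then show False using cyc_eqI[OF ab(1)] cyc_eqI[OF ab(3)] t t' T(3) by simp
      qed
      then show "enriched_maps q T \<inter> enriched_maps q T' = {}" by blast
    qed
  qed
  then show ?thesis
    using bij_betw_same_card[OF enriched_maps_split[OF assms, of q]] by (simp add: card_cartesian_product)
qed

unbundle fps_syntax

section \<open>Enriched maps of a linear permutation\<close>

fun lin_peaks :: "nat list \<Rightarrow> nat" where
  "lin_peaks (x # y # z # zs) = (if x < y \<and> z < y then 1 else 0) + lin_peaks (y # z # zs)"
| "lin_peaks _ = 0"

text \<open>
  The number of enriched maps of a linear permutation in which the first letter has the value \<open>v\<close>: the
  second letter has a smaller value, or the same one if the parity of \<open>v\<close> allows the step.
\<close>
fun first_value_count :: "nat list \<Rightarrow> nat \<Rightarrow> nat" where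
  "first_value_count [] v = 0"
| "first_value_count [x] v = 1"
| "first_value_count (x # y # zs) v = (\<Sum>u<v. first_value_count (y # zs) u) +
     (if (if even v then x < y else y < x) then first_value_count (y # zs) v else 0)"

text \<open>
  The order is transitive, so only adjacent letters have to be compared, and a map for \<open>x # y # zs\<close> is
  a map for \<open>y # zs\<close> together with an admissible value of \<open>x\<close>. As that value is the largest one,
  all other values are below \<open>q\<close> as well.
\<close>
lemma card_enriched_first_value:
  assumes "distinct (x # xs)" "v < q"
  shows "card {f \<in> set (x # xs) \<rightarrow>\<^sub>E {..<q}. f x = v \<and> sorted_wrt (before f) (x # xs)} =
         first_value_count (x # xs) v"
  using assms
proof (induction xs arbitrary: x v)
  case Nil
  have "{f \<in> set [x] \<rightarrow>\<^sub>E {..<q}. f x = v \<and> sorted_wrt (before f) [x]} = {\<lambda>a\<in>{x}. v}"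
    using Nil by (auto simp: PiE_iff extensional_def fun_eq_iff)
  then show ?case by simp
next
  case (Cons y zs)
  let ?M = "\<lambda>u. {f \<in> set (y # zs) \<rightarrow>\<^sub>E {..<q}. f y = u \<and> sorted_wrt (before f) (y # zs)}"
  \<comment> \<open>The values allowed for \<open>y\<close>.\<close>
  let ?U = "{u. u < v \<or> u = v \<and> (if even v then x < y else y < x)}"
  have x: "x \<notin> set (y # zs)" using Cons.prems by simp
  have fin: "finite (?M u)" for u
    by (rule finite_subset[of _ "set (y # zs) \<rightarrow>\<^sub>E {..<q}"]) (auto intro: finite_PiE)
  have upd: "sorted_wrt (before (f(x := v))) (y # zs) \<longleftrightarrow> sorted_wrt (before f) (y # zs)" for f
    by (rule sorted_before_cong) (use x in auto)
  have "bij_betw (\<lambda>f. f(x := v)) (\<Union>u\<in>?U. ?M u)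
      {f \<in> set (x # y # zs) \<rightarrow>\<^sub>E {..<q}. f x = v \<and> sorted_wrt (before f) (x # y # zs)}"
  proof (rule bij_betw_byWitness[where f' = "\<lambda>f. restrict f (set (y # zs))"])
    show "\<forall>f\<in>\<Union>u\<in>?U. ?M u. restrict (f(x := v)) (set (y # zs)) = f"
      using x by (fastforce simp: fun_eq_iff PiE_iff extensional_def)
    show "\<forall>f\<in>{f \<in> set (x # y # zs) \<rightarrow>\<^sub>E {..<q}. f x = v \<and> sorted_wrt (before f) (x # y # zs)}.
        (restrict f (set (y # zs)))(x := v) = f"
      by (auto simp: fun_eq_iff PiE_iff extensional_def)
    show "(\<lambda>f. f(x := v)) ` (\<Union>u\<in>?U. ?M u) \<subseteq>
        {f \<in> set (x # y # zs) \<rightarrow>\<^sub>E {..<q}. f x = v \<and> sorted_wrt (before f) (x # y # zs)}"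
    proof (rule image_subsetI)
      fix f assume "f \<in> (\<Union>u\<in>?U. ?M u)"
      then have u: "f y < v \<or> f y = v \<and> (if even v then x < y else y < x)"
        and f: "f \<in> set (y # zs) \<rightarrow>\<^sub>E {..<q}" "sorted_wrt (before f) (y # zs)"
        by blast+
      have "before (f(x := v)) x y" using u x by (auto simp: before_def)
      then show "f(x := v) \<in> {f \<in> set (x # y # zs) \<rightarrow>\<^sub>E {..<q}. f x = v \<and>
          sorted_wrt (before f) (x # y # zs)}"
        using f \<open>v < q\<close> upd[of f]
        unfolding sorted_wrt2[OF transp_before] by (auto simp: PiE_iff extensional_def)
    qed
    show "(\<lambda>f. restrict f (set (y # zs))) `
        {f \<in> set (x # y # zs) \<rightarrow>\<^sub>E {..<q}. f x = v \<and> sorted_wrt (before f) (x # y # zs)}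
        \<subseteq> (\<Union>u\<in>?U. ?M u)"
    proof (rule image_subsetI)
      fix f assume "f \<in> {f \<in> set (x # y # zs) \<rightarrow>\<^sub>E {..<q}. f x = v \<and> sorted_wrt (before f) (x # y # zs)}"
      then have f: "f \<in> set (x # y # zs) \<rightarrow>\<^sub>E {..<q}" "sorted_wrt (before f) (x # y # zs)" "f x = v"
        by blast+
      have "before f x y" "sorted_wrt (before f) (y # zs)"
        using f(2) unfolding sorted_wrt2[OF transp_before] by auto
      moreover have "sorted_wrt (before (restrict f (set (y # zs)))) (y # zs)
          \<longleftrightarrow> sorted_wrt (before f) (y # zs)" by (rule sorted_before_cong) simp
      moreover have "restrict f (set (y # zs)) \<in> set (y # zs) \<rightarrow>\<^sub>E {..<q}"
        using f(1) by (auto simp: PiE_iff)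
      moreover have "f y \<in> ?U" using \<open>before f x y\<close> f(3) by (auto simp: before_def)
      ultimately show "restrict f (set (y # zs)) \<in> (\<Union>u\<in>?U. ?M u)"
        by (intro UN_I[of "f y"]) auto
    qed
  qed
  then have "card {f \<in> set (x # y # zs) \<rightarrow>\<^sub>E {..<q}. f x = v \<and> sorted_wrt (before f) (x # y # zs)}
      = card (\<Union>u\<in>?U. ?M u)" by (simp add: bij_betw_same_card)
  also have "\<dots> = (\<Sum>u\<in>?U. card (?M u))"
    by (rule card_UN_disjoint) (use fin in auto)
  also have "\<dots> = (\<Sum>u\<in>?U. first_value_count (y # zs) u)"
    by (rule sum.cong[OF refl], rule Cons.IH) (use Cons.prems in auto)
  also have "?U = {..<v} \<union> (if (if even v then x < y else y < x) then {v} else {})" by auto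
  also have "(\<Sum>u\<in>\<dots>. first_value_count (y # zs) u) = first_value_count (x # y # zs) v"
    by (auto simp: sum.union_disjoint)
  finally show ?case .
qed

lemma card_linear_enriched_maps:
  assumes "distinct \<pi>" "\<pi> \<noteq> []"
  shows "card {f \<in> set \<pi> \<rightarrow>\<^sub>E {..<q}. sorted_wrt (before f) \<pi>} = (\<Sum>v<q. first_value_count \<pi> v)"
proof -
  obtain x xs where p: "\<pi> = x # xs" using assms(2) by (cases \<pi>) auto
  let ?M = "\<lambda>v. {f \<in> set (x # xs) \<rightarrow>\<^sub>E {..<q}. f x = v \<and> sorted_wrt (before f) (x # xs)}"
  have "{f \<in> set \<pi> \<rightarrow>\<^sub>E {..<q}. sorted_wrt (before f) \<pi>} = (\<Union>v\<in>{..<q}. ?M v)"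
    unfolding p by (auto simp: PiE_iff)
  also have "card \<dots> = (\<Sum>v<q. card (?M v))"
  proof (rule card_UN_disjoint)
    have "finite (set (x # xs) \<rightarrow>\<^sub>E {..<q})" by (intro finite_PiE) auto
    then show "\<forall>v\<in>{..<q}. finite (?M v)" by (auto elim: finite_subset[rotated])
  qed auto
  also have "\<dots> = (\<Sum>v<q. first_value_count \<pi> v)"
    unfolding p by (rule sum.cong[OF refl], rule card_enriched_first_value) (use assms p in auto)
  finally show ?thesis .
qed

text \<open>
  Whether a value may be repeated depends on its parity only, so the counts are collected in two
  series, with \<open>t\<close> marking half of the first value, rounded down. In these terms the recursion is
  linear with coefficients in \<open>t\<close> and \<open>1 / (1 - t)\<close>, where the latter forms partial sums.
\<close>
definition even_fps :: "nat list \<Rightarrow> rat fps" where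
  "even_fps \<pi> = Abs_fps (\<lambda>b. of_nat (first_value_count \<pi> (2 * b)))"

definition odd_fps :: "nat list \<Rightarrow> rat fps" where
  "odd_fps \<pi> = Abs_fps (\<lambda>b. of_nat (first_value_count \<pi> (2 * b + 1)))"

abbreviation geom :: "rat fps" where
  "geom \<equiv> inverse (1 - fps_X)"

lemma geom_mult: "geom * (1 - fps_X) = 1"
  by (rule inverse_mult_eq_1) simp

lemma fps_geom_mult_nth: "(geom * F) $ n = (\<Sum>i\<le>n. F $ i)"
proof -
  have "geom * F = F / (1 - fps_X)" by (simp add: fps_divide_unit mult.commute)
  then show ?thesis by (simp add: fps_divide_fps_X_minus1_sum atMost_atLeast0)
qed

lemma fps_X_geom_mult_nth: "(fps_X * (geom * F)) $ n = (\<Sum>i<n. F $ i)"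
  by (cases n) (simp_all add: fps_geom_mult_nth lessThan_Suc_atMost)

lemma sum_lessThan_double: "(\<Sum>u<2 * b. g u) = (\<Sum>i<b. g (2 * i) + g (2 * i + 1))"
  for g :: "nat \<Rightarrow> nat"
  by (induction b) simp_all

lemma even_fps_Cons:
  "even_fps (x # y # zs) = fps_X * (geom * (even_fps (y # zs) + odd_fps (y # zs))) +
     (if x < y then even_fps (y # zs) else 0)"
proof (rule fps_ext)
  fix b show "even_fps (x # y # zs) $ b = (fps_X * (geom * (even_fps (y # zs) + odd_fps (y # zs))) +
     (if x < y then even_fps (y # zs) else 0)) $ b"
    unfolding fps_add_nth fps_X_geom_mult_nth
    by (simp add: even_fps_def odd_fps_def sum_lessThan_double)
qed

lemma odd_fps_Cons:
  "odd_fps (x # y # zs) = fps_X * (geom * (even_fps (y # zs) + odd_fps (y # zs))) + even_fps (y # zs) +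
     (if y < x then odd_fps (y # zs) else 0)"
proof (rule fps_ext)
  fix b show "odd_fps (x # y # zs) $ b = (fps_X * (geom * (even_fps (y # zs) + odd_fps (y # zs)))
     + even_fps (y # zs) + (if y < x then odd_fps (y # zs) else 0)) $ b"
    unfolding fps_add_nth fps_X_geom_mult_nth
    by (simp add: even_fps_def odd_fps_def sum_lessThan_double)
qed

text \<open>
  If the list has one letter or starts with an ascent, then the two series agree; if it starts with a
  descent, then the even one is \<open>t\<close> times the odd one. In both states their sum gets the factor
  \<open>(1 + t) / (1 - t)\<close> from every letter put in front, except that an ascent put in front of a
  descent, which creates a peak, contributes \<open>4t / ((1 - t)(1 + t))\<close>. The inequalities between \<open>k\<close> and \<open>n\<close> are
  carried along so that the truncated exponents are the true ones.
\<close>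
lemma even_odd_fps:
  assumes "distinct (x # xs)"
  defines "k \<equiv> lin_peaks (x # xs)" and "n \<equiv> length (x # xs)"
  shows "(if xs = [] \<or> x < hd xs
          then 2 * k + 1 \<le> n \<and>
               even_fps (x # xs) = geom ^ n * (1 + fps_X) ^ (n - 1 - 2 * k) * (4 * fps_X) ^ k \<and>
               odd_fps (x # xs) = even_fps (x # xs)
          else 2 * k + 2 \<le> n \<and>
               odd_fps (x # xs) = 2 * geom ^ n * (1 + fps_X) ^ (n - 2 - 2 * k) * (4 * fps_X) ^ k \<and>
               even_fps (x # xs) = fps_X * odd_fps (x # xs))"
  using assms(1) unfolding k_def n_def
proof (induction xs arbitrary: x)
  case Nil
  have "geom = Abs_fps (\<lambda>n. 1)" by (simp add: fps_inverse_one_minus_fps_X)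
  then show ?case by (simp add: even_fps_def odd_fps_def)
next
  case (Cons y zs)
  let ?s = "y # zs"
  let ?k = "lin_peaks ?s" and ?n = "length ?s"
  have ne: "x \<noteq> y" using Cons.prems by simp
  \<comment> \<open>Writing \<open>t / (1 - t)\<close> as \<open>1 / (1 - t) - 1\<close> makes the recursion polynomial in \<open>1 / (1 - t)\<close>.\<close>
  have g: "fps_X * geom = geom - 1" using geom_mult by (simp add: algebra_simps)
  have E: "even_fps (x # ?s) = (geom - 1) * (even_fps ?s + odd_fps ?s) + (if x < y then even_fps ?s else 0)"
    unfolding even_fps_Cons mult.assoc[symmetric] g ..
  have O: "odd_fps (x # ?s) = (geom - 1) * (even_fps ?s + odd_fps ?s) + even_fps ?s
      + (if y < x then odd_fps ?s else 0)"
    unfolding odd_fps_Cons mult.assoc[symmetric] g ..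
  have gp: "geom * (1 + fps_X) = 2 * geom - 1" using g by (simp add: algebra_simps)
  show ?case
  proof (cases "zs = [] \<or> y < hd zs")
    case True
    then have k: "lin_peaks (x # ?s) = ?k" by (cases zs) auto
    have IH: "2 * ?k + 1 \<le> ?n"
      "even_fps ?s = geom ^ ?n * (1 + fps_X) ^ (?n - 1 - 2 * ?k) * (4 * fps_X) ^ ?k"
      "odd_fps ?s = even_fps ?s"
      using Cons.IH[of y] Cons.prems True by auto
    show ?thesis
    proof (cases "x < y")
      case less: True
      have "even_fps (x # ?s) = (2 * geom - 1) * even_fps ?s" "odd_fps (x # ?s) = even_fps (x # ?s)"
        unfolding E O using less IH(3) by (simp_all add: algebra_simps)
      moreover have "length (x # ?s) - 1 - 2 * ?k = Suc (?n - 1 - 2 * ?k)" using IH(1) by simp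
      ultimately show ?thesis using less IH(1,2) unfolding k gp[symmetric]
        by (simp add: algebra_simps)
    next
      case False
      then have "y < x" using ne by simp
      have "odd_fps (x # ?s) = 2 * geom * even_fps ?s"
        "even_fps (x # ?s) = fps_X * geom * (2 * even_fps ?s)"
        unfolding E O g using \<open>y < x\<close> IH(3) by (simp_all add: algebra_simps)
      then show ?thesis using \<open>y < x\<close> IH(1,2) unfolding k by (simp add: algebra_simps)
    qed
  next
    case False
    then obtain z ws where zs: "zs = z # ws" "z \<noteq> y" "z < y" using Cons.prems by (cases zs) auto
    have k: "lin_peaks (x # ?s) = (if x < y then 1 else 0) + ?k" using zs by simp
    have IH: "2 * ?k + 2 \<le> ?n"
      "odd_fps ?s = 2 * geom ^ ?n * (1 + fps_X) ^ (?n - 2 - 2 * ?k) * (4 * fps_X) ^ ?k"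
      "even_fps ?s = fps_X * odd_fps ?s"
      using Cons.IH[of y] Cons.prems False by auto
    show ?thesis
    proof (cases "x < y")
      case less: True
      have "even_fps (x # ?s) = (geom * (1 + fps_X) - 1) * odd_fps ?s"
        unfolding E using less IH(3) by (simp add: algebra_simps)
      also have "\<dots> = 2 * (geom - 1) * odd_fps ?s" unfolding gp by (simp add: algebra_simps)
      finally have "even_fps (x # ?s) = 2 * (fps_X * geom) * odd_fps ?s" unfolding g .
      moreover have "odd_fps (x # ?s) = even_fps (x # ?s)"
        unfolding E O using less by simp
      moreover have "length (x # ?s) - 1 - 2 * Suc ?k = ?n - 2 - 2 * ?k" using IH(1) by simp
      ultimately show ?thesis using less IH(1,2) unfolding k
        by (simp add: algebra_simps)
    next
      case False
      then have "y < x" using ne by simp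
      have "odd_fps (x # ?s) = geom * (1 + fps_X) * odd_fps ?s"
        "even_fps (x # ?s) = (fps_X * geom) * ((1 + fps_X) * odd_fps ?s)"
        unfolding E O g using \<open>y < x\<close> IH(3) by (simp_all add: algebra_simps)
      moreover have "length (x # ?s) - 2 - 2 * ?k = Suc (?n - 2 - 2 * ?k)" using IH(1) by simp
      ultimately show ?thesis using \<open>y < x\<close> IH(1,2) unfolding k by (simp add: algebra_simps)
    qed
  qed
qed

text \<open>
  Summing the counts over all first values below \<open>2p\<close> multiplies the sum of the two series by
  \<open>t / (1 - t)\<close>.
\<close>
lemma linear_enriched_fps:
  assumes "distinct \<pi>" "\<pi> \<noteq> []"
  shows "2 * lin_peaks \<pi> + 1 \<le> length \<pi>"
    and "Abs_fps (\<lambda>p. of_nat (card {f \<in> set \<pi> \<rightarrow>\<^sub>E {..<2 * p}. sorted_wrt (before f) \<pi>})) =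
      2 * fps_X * geom ^ (length \<pi> + 1) * (1 + fps_X) ^ (length \<pi> - 1 - 2 * lin_peaks \<pi>)
        * (4 * fps_X) ^ lin_peaks \<pi>"
proof -
  obtain x xs where p: "\<pi> = x # xs" using assms(2) by (cases \<pi>) auto
  let ?n = "length \<pi>" and ?k = "lin_peaks \<pi>"
  note eo = even_odd_fps[of x xs, folded p, OF assms(1)]
  show "2 * ?k + 1 \<le> ?n" using eo by (auto split: if_splits)
  have s: "even_fps \<pi> + odd_fps \<pi> = 2 * geom ^ ?n * (1 + fps_X) ^ (?n - 1 - 2 * ?k) * (4 * fps_X) ^ ?k"
  proof (cases "xs = [] \<or> x < hd xs")
    case True
    then have "even_fps \<pi> = geom ^ ?n * (1 + fps_X) ^ (?n - 1 - 2 * ?k) * (4 * fps_X) ^ ?k"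
      "odd_fps \<pi> = even_fps \<pi>" using eo by auto
    then show ?thesis by simp
  next
    case False
    then have o: "2 * ?k + 2 \<le> ?n"
      "odd_fps \<pi> = 2 * geom ^ ?n * (1 + fps_X) ^ (?n - 2 - 2 * ?k) * (4 * fps_X) ^ ?k"
      "even_fps \<pi> = fps_X * odd_fps \<pi>" using eo by auto
    have "even_fps \<pi> + odd_fps \<pi> = (1 + fps_X) * odd_fps \<pi>"
      using o(3) by (simp add: algebra_simps)
    moreover have "?n - 1 - 2 * ?k = Suc (?n - 2 - 2 * ?k)" using o(1) by simp
    ultimately show ?thesis unfolding o(2) by (simp add: mult_ac)
  qed
  have "Abs_fps (\<lambda>p. of_nat (card {f \<in> set \<pi> \<rightarrow>\<^sub>E {..<2 * p}. sorted_wrt (before f) \<pi>})) =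
      fps_X * (geom * (even_fps \<pi> + odd_fps \<pi>))"
  proof (rule fps_ext)
    fix b
    show "Abs_fps (\<lambda>p. of_nat (card {f \<in> set \<pi> \<rightarrow>\<^sub>E {..<2 * p}. sorted_wrt (before f) \<pi>})) $ b =
        (fps_X * (geom * (even_fps \<pi> + odd_fps \<pi>))) $ b"
      unfolding fps_X_geom_mult_nth
      by (simp add: card_linear_enriched_maps[OF assms] sum_lessThan_double even_fps_def odd_fps_def)
  qed
  then show "Abs_fps (\<lambda>p. of_nat (card {f \<in> set \<pi> \<rightarrow>\<^sub>E {..<2 * p}. sorted_wrt (before f) \<pi>})) =
      2 * fps_X * geom ^ (?n + 1) * (1 + fps_X) ^ (?n - 1 - 2 * ?k) * (4 * fps_X) ^ ?k"
    unfolding s by (simp add: mult_ac)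
qed

section \<open>Cyclic peaks and the interior peaks of the rotations\<close>

definition cyc_peak :: "nat list \<Rightarrow> nat \<Rightarrow> bool" where
  "cyc_peak \<pi> i \<longleftrightarrow> i < length \<pi> \<and>
     \<pi> ! ((i + length \<pi> - 1) mod length \<pi>) < \<pi> ! i \<and> \<pi> ! ((i + 1) mod length \<pi>) < \<pi> ! i"

lemma cpk_lin_eq: "cpk_lin \<pi> = card {i. cyc_peak \<pi> i}"
  by (simp add: cpk_lin_def cyc_peak_def)

lemma finite_cyc_peaks: "finite {i. cyc_peak \<pi> i}"
  by (rule finite_subset[of _ "{..<length \<pi>}"]) (auto simp: cyc_peak_def)

lemma cyc_peak_rotate:
  assumes "i < length \<pi>"
  shows "cyc_peak (rotate k \<pi>) i \<longleftrightarrow> cyc_peak \<pi> ((k + i) mod length \<pi>)"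
proof -
  let ?n = "length \<pi>"
  have n: "?n > 0" using assms by linarith
  have nth: "rotate k \<pi> ! j = \<pi> ! ((k + j) mod ?n)" if "j < ?n" for j
    using that by (simp add: nth_rotate)
  have e: "j + ?n - 1 = j + (?n - 1)" for j using n by linarith
  have pre: "(k + (i + ?n - 1) mod ?n) mod ?n = ((k + i) mod ?n + ?n - 1) mod ?n"
    unfolding e by (simp only: mod_add_right_eq mod_add_left_eq add.assoc)
  have suc: "(k + (i + 1) mod ?n) mod ?n = ((k + i) mod ?n + 1) mod ?n"
    by (simp add: mod_simps)
  have lt: "(i + ?n - 1) mod ?n < ?n" "(i + 1) mod ?n < ?n" "(k + i) mod ?n < ?n" using n by simp_all
  show ?thesis
    unfolding cyc_peak_def length_rotate nth[OF lt(1)] nth[OF lt(2)] nth[OF assms] pre suc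
    using assms lt(3) by simp
qed

lemma lin_peaks_eq_card:
  "lin_peaks xs = card {i. i + 2 < length xs \<and> xs ! i < xs ! (i + 1) \<and> xs ! (i + 2) < xs ! (i + 1)}"
proof (induction xs rule: lin_peaks.induct)
  case (1 x y z zs)
  let ?I = "\<lambda>xs. {i. i + 2 < length xs \<and> xs ! i < xs ! (i + 1) \<and> xs ! (i + 2) < xs ! (i + 1)}"
  have fin: "finite (?I xs)" for xs :: "nat list"
    by (rule finite_subset[of _ "{..<length xs}"]) auto
  have shift: "card ((if b then {0} else {}) \<union> Suc ` B) = (if b then 1 else 0) + card B"
    if "finite B" for b and B :: "nat set"
    using that by (cases b) (auto simp: card_image card_insert_if)
  have I: "?I (x # y # z # zs) = (if x < y \<and> z < y then {0} else {}) \<union> Suc ` ?I (y # z # zs)"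
    (is "?L = ?R")
  proof (rule Set.set_eqI)
    fix i show "i \<in> ?L \<longleftrightarrow> i \<in> ?R" by (cases i) auto
  qed
  show ?case unfolding I shift[OF fin] lin_peaks.simps 1 ..
qed auto

text \<open>
  Only the first and the last position can be cyclic peaks without being interior, and being cyclic
  neighbours they cannot both be peaks.
\<close>
lemma cpk_lin_conv_lin_peaks:
  assumes "\<rho> \<noteq> []"
  shows "cpk_lin \<rho> = lin_peaks \<rho> + (if cyc_peak \<rho> 0 \<or> cyc_peak \<rho> (length \<rho> - 1) then 1 else 0)"
    and "\<not> (cyc_peak \<rho> 0 \<and> cyc_peak \<rho> (length \<rho> - 1))"
proof -
  let ?n = "length \<rho>"
  let ?I = "{i. i + 2 < ?n \<and> \<rho> ! i < \<rho> ! (i + 1) \<and> \<rho> ! (i + 2) < \<rho> ! (i + 1)}"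
  let ?E = "{i. (i = 0 \<or> i = ?n - 1) \<and> cyc_peak \<rho> i}"
  have n: "?n > 0" using assms by simp
  show ex: "\<not> (cyc_peak \<rho> 0 \<and> cyc_peak \<rho> (?n - 1))"
    using n by (auto simp: cyc_peak_def)
  have "{i. cyc_peak \<rho> i} = Suc ` ?I \<union> ?E"
  proof (rule Set.set_eqI)
    fix i show "i \<in> {i. cyc_peak \<rho> i} \<longleftrightarrow> i \<in> Suc ` ?I \<union> ?E"
    proof (cases "i = 0 \<or> i \<ge> ?n - 1")
      case True
      then show ?thesis by (auto simp: cyc_peak_def)
    next
      case False
      then obtain j where j: "i = Suc j" "j + 2 < ?n" by (cases i) auto
      then have "(i + ?n - 1) mod ?n = j" "(i + 1) mod ?n = j + 2" by simp_all
      then show ?thesis using j False by (auto simp: cyc_peak_def)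
    qed
  qed
  moreover have fin: "finite ?I" by (rule finite_subset[of _ "{..<?n}"]) auto
  moreover have "Suc ` ?I \<inter> ?E = {}" by auto
  moreover have "finite ?E" by (rule finite_subset[OF _ finite_cyc_peaks]) auto
  ultimately have "card {i. cyc_peak \<rho> i} = card ?I + card ?E"
    by (simp add: card_Un_disjoint card_image)
  moreover have "?E = (if cyc_peak \<rho> 0 then {0} else if cyc_peak \<rho> (?n - 1) then {?n - 1} else {})"
    using ex by (auto; metis gr0I)
  ultimately show "cpk_lin \<rho> = lin_peaks \<rho> + (if cyc_peak \<rho> 0 \<or> cyc_peak \<rho> (?n - 1) then 1 else 0)"
    unfolding cpk_lin_eq lin_peaks_eq_card by auto
qed

text \<open>
  The rotation by \<open>k\<close> starts with the letter at position \<open>k\<close> and ends with the one before it. Let \<open>A\<close> be the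
  set of \<open>k\<close> for which the rotation starts with a peak and \<open>B\<close> the set of those for which it ends with one.
  Both have \<open>c\<close> elements and they are disjoint, which also bounds \<open>2c\<close> by the length. For \<open>c = 0\<close> the
  truncated \<open>c - 1\<close> comes with the coefficient \<open>0\<close>.
\<close>
lemma sum_rotations_lin_peaks:
  fixes g :: "nat \<Rightarrow> 'a :: comm_ring_1"
  assumes "\<pi> \<noteq> []"
  defines "n \<equiv> length \<pi>" and "c \<equiv> cpk_lin \<pi>"
  shows "2 * c \<le> n"
    and "(\<Sum>k<n. g (lin_peaks (rotate k \<pi>))) = of_nat (2 * c) * g (c - 1) + of_nat (n - 2 * c) * g c"
proof -
  let ?f = "\<lambda>k. (k + (n - 1)) mod n"
  let ?A = "{k. cyc_peak \<pi> k}" and ?B = "{k. k < n \<and> cyc_peak \<pi> (?f k)}"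
  have n: "n > 0" using assms(1) by (simp add: n_def)
  have A: "cyc_peak (rotate k \<pi>) 0 \<longleftrightarrow> k \<in> ?A" if "k < n" for k
    using cyc_peak_rotate[of 0 \<pi> k] n that by (simp add: n_def)
  have B: "cyc_peak (rotate k \<pi>) (n - 1) \<longleftrightarrow> k \<in> ?B" if "k < n" for k
    using cyc_peak_rotate[of "n - 1" \<pi> k] n that by (simp add: n_def)
  have sub: "?A \<subseteq> {..<n}" "?B \<subseteq> {..<n}" by (auto simp: n_def cyc_peak_def)
  have disj: "?A \<inter> ?B = {}"
    using A B cpk_lin_conv_lin_peaks(2)[of "rotate _ \<pi>"] assms(1) sub by (fastforce simp: n_def)
  \<comment> \<open>A rotation ends with the letter at position \<open>k\<close> iff it starts with the next one.\<close>
  have "bij_betw (\<lambda>k. (k + 1) mod n) ?A ?B"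
  proof (rule bij_betw_byWitness[where f' = ?f])
    have fg: "((k + (n - 1)) mod n + 1) mod n = k" "((k + 1) mod n + (n - 1)) mod n = k" if "k < n" for k
    proof -
      have "((k + (n - 1)) mod n + 1) mod n = (k + (n - 1) + 1) mod n" by (rule mod_add_left_eq)
      then show "((k + (n - 1)) mod n + 1) mod n = k" using that by simp
      have "((k + 1) mod n + (n - 1)) mod n = (k + 1 + (n - 1)) mod n" by (rule mod_add_left_eq)
      then show "((k + 1) mod n + (n - 1)) mod n = k" using that by simp
    qed
    show "\<forall>k\<in>?A. ?f ((k + 1) mod n) = k" "\<forall>k\<in>?B. (?f k + 1) mod n = k"
      using fg sub by auto
    show "(\<lambda>k. (k + 1) mod n) ` ?A \<subseteq> ?B"
      using fg(2) sub(1) n by (auto simp: subset_iff)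
    show "?f ` ?B \<subseteq> ?A" by auto
  qed
  then have card: "card ?A = c" "card ?B = c"
    unfolding c_def cpk_lin_eq by (auto dest: bij_betw_same_card)
  have fin: "finite ?A" "finite ?B" using sub by (auto intro: finite_subset)
  have AB: "card (?A \<union> ?B) = 2 * c" using card fin disj by (simp add: card_Un_disjoint)
  show "2 * c \<le> n" using card_mono[of "{..<n}" "?A \<union> ?B"] AB sub by simp
  have lp: "lin_peaks (rotate k \<pi>) = (if k \<in> ?A \<union> ?B then c - 1 else c)" if "k < n" for k
    using cpk_lin_conv_lin_peaks(1)[of "rotate k \<pi>"] assms(1) A[OF that] B[OF that]
    by (auto simp: cpk_lin_rotate c_def n_def)
  have AB_sub: "?A \<union> ?B \<subseteq> {..<n}" using sub by blast
  have AB_diff: "card ({..<n} - (?A \<union> ?B)) = n - 2 * c"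
    using card_Diff_subset[OF _ AB_sub] AB fin by simp
  have "(\<Sum>k<n. g (lin_peaks (rotate k \<pi>))) =
      (\<Sum>k\<in>{..<n} - (?A \<union> ?B). g (lin_peaks (rotate k \<pi>))) + (\<Sum>k\<in>?A \<union> ?B. g (lin_peaks (rotate k \<pi>)))"
    by (rule sum.subset_diff[OF AB_sub]) simp
  also have "\<dots> = (\<Sum>k\<in>{..<n} - (?A \<union> ?B). g c) + (\<Sum>k\<in>?A \<union> ?B. g (c - 1))"
    using AB_sub by (intro arg_cong2[of _ _ _ _ "(+)"] sum.cong refl) (subst lp; auto)+
  also have "\<dots> = of_nat (2 * c) * g (c - 1) + of_nat (n - 2 * c) * g c"
    unfolding sum_constant AB AB_diff by (rule add.commute)
  finally show "(\<Sum>k<n. g (lin_peaks (rotate k \<pi>))) = of_nat (2 * c) * g (c - 1) + of_nat (n - 2 * c) * g c" .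
qed

lemma card_enriched_maps_rotations:
  assumes "distinct \<pi>"
  shows "card (enriched_maps q (cyc \<pi>)) = (\<Sum>\<tau>\<in>cyc \<pi>. card {f \<in> set \<tau> \<rightarrow>\<^sub>E {..<q}. sorted_wrt (before f) \<tau>})"
proof -
  let ?M = "\<lambda>\<tau>. {f \<in> set \<tau> \<rightarrow>\<^sub>E {..<q}. sorted_wrt (before f) \<tau>}"
  have "enriched_maps q (cyc \<pi>) = (\<Union>\<tau>\<in>cyc \<pi>. ?M \<tau>)"
    unfolding enriched_maps_cyc using cyc_memD(1) by blast
  also have "card \<dots> = (\<Sum>\<tau>\<in>cyc \<pi>. card (?M \<tau>))"
  proof (rule card_UN_disjoint)
    have "cyc \<pi> \<subseteq> {\<tau>. set \<tau> \<subseteq> set \<pi> \<and> length \<tau> = length \<pi>}" by (auto dest: cyc_memD)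
    then show "finite (cyc \<pi>)" by (rule finite_subset) (simp add: finite_lists_length_eq)
    show "\<forall>\<tau>\<in>cyc \<pi>. finite (?M \<tau>)"
    proof
      fix \<tau> :: "nat list"
      have "finite (set \<tau> \<rightarrow>\<^sub>E {..<q})" by (intro finite_PiE) auto
      then show "finite (?M \<tau>)" by (rule finite_subset[rotated]) auto
    qed
    show "\<forall>\<tau>\<in>cyc \<pi>. \<forall>\<tau>'\<in>cyc \<pi>. \<tau> \<noteq> \<tau>' \<longrightarrow> ?M \<tau> \<inter> ?M \<tau>' = {}"
      using sorted_before_unique cyc_memD(1) by fastforce
  qed
  finally show ?thesis .
qed

text \<open>
  The letters are distinct, so the first letter tells the rotations apart.
\<close>
lemma bij_betw_rotate_cyc:
  assumes "distinct \<pi>" "\<pi> \<noteq> []"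
  shows "bij_betw (\<lambda>k. rotate k \<pi>) {..<length \<pi>} (cyc \<pi>)"
  unfolding bij_betw_def
proof
  show "inj_on (\<lambda>k. rotate k \<pi>) {..<length \<pi>}"
  proof (rule inj_onI)
    fix j k assume jk: "j \<in> {..<length \<pi>}" "k \<in> {..<length \<pi>}" "rotate j \<pi> = rotate k \<pi>"
    then have "\<pi> ! j = \<pi> ! k" using assms(2) hd_rotate_conv_nth[of \<pi>] by (metis lessThan_iff mod_less)
    then show "j = k" using jk assms(1) by (simp add: nth_eq_iff_index_eq)
  qed
  show "(\<lambda>k. rotate k \<pi>) ` {..<length \<pi>} = cyc \<pi>"
  proof
    show "cyc \<pi> \<subseteq> (\<lambda>k. rotate k \<pi>) ` {..<length \<pi>}"
    proof
      fix \<tau> assume "\<tau> \<in> cyc \<pi>"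
      then obtain k where "\<tau> = rotate k \<pi>" by (auto simp: cyc_def)
      then have "\<tau> = rotate (k mod length \<pi>) \<pi>" by (simp add: rotate_conv_mod[of k])
      then show "\<tau> \<in> (\<lambda>k. rotate k \<pi>) ` {..<length \<pi>}" using assms(2) by simp
    qed
  qed (auto simp: cyc_def)
qed

text \<open>
  The two summands of the numerator are separated so that all exponents are natural numbers: for
  \<open>n = 2j\<close> the factor \<open>(1 + t) powi (-1)\<close> cancels in the first one, and the second one vanishes.
\<close>
lemma cpk_fps_eq:
  assumes "2 * j \<le> n" "1 \<le> n"
  shows "cpk_fps n j = of_nat j * (4 * fps_X) ^ j * (1 + fps_X) ^ (n - 2 * j + 1) * geom ^ (n + 1)
    + 2 * of_nat (n - 2 * j) * (4 * fps_X) ^ j * fps_X * (1 + fps_X) ^ (n - 2 * j - 1) * geom ^ (n + 1)"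
proof -
  let ?Y = "1 + fps_X :: rat fps"
  have "F / (1 - fps_X) ^ (n + 1) = F * geom ^ (n + 1)" for F :: "rat fps"
    by (subst fps_divide_unit) (simp_all add: fps_inverse_power del: power_Suc)
  moreover have "of_nat n - 2 * of_nat j = (of_nat (n - 2 * j) :: rat fps)"
    using assms(1) by (simp add: of_nat_diff)
  ultimately have def: "cpk_fps n j = (of_nat j * ?Y ^ 2 + 2 * of_nat (n - 2 * j) * fps_X) * (4 * fps_X) ^ j
      * ?Y powi (int n - 2 * int j - 1) * geom ^ (n + 1)"
    unfolding cpk_fps_def by simp
  show ?thesis
  proof (cases "n = 2 * j")
    case True
    have "?Y * inverse ?Y = 1" by (rule inverse_mult_eq_1') simp
    then have "?Y ^ 2 * ?Y powi (-1) = ?Y" by (simp add: power2_eq_square power_int_minus1_right mult.assoc)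
    then have "of_nat j * ?Y ^ 2 * (4 * fps_X) ^ j * ?Y powi (-1) * geom ^ (n + 1) =
        of_nat j * (4 * fps_X) ^ j * ?Y * geom ^ (n + 1)" by (simp add: mult_ac)
    then show ?thesis unfolding def using True by simp
  next
    case False
    then obtain d where d: "n = 2 * j + Suc d" using assms(1) by (metis add_Suc_right le_neq_implies_less less_imp_Suc_add)
    have "?Y powi (int n - 2 * int j - 1) = ?Y ^ d" unfolding d by simp
    then show ?thesis unfolding def unfolding d by (simp add: algebra_simps power2_eq_square)
  qed
qed

text \<open>
  With \<open>L k\<close> the series of a linear permutation with \<open>k\<close> interior peaks, the sum over the rotations is
  \<open>2c L(c - 1) + (n - 2c) L(c)\<close>.
\<close>
theorem enriched_maps_fps:
  assumes "lin_perm \<pi>" "\<pi> \<noteq> []"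
  shows "Abs_fps (\<lambda>p. of_nat (card (enriched_maps (2 * p) (cyc \<pi>)))) = cpk_fps (length \<pi>) (cpk (cyc \<pi>))"
proof -
  let ?n = "length \<pi>" and ?c = "cpk_lin \<pi>"
  have d: "distinct \<pi>" using assms(1) by (simp add: lin_perm_def)
  define L where "L k = 2 * fps_X * geom ^ (?n + 1) * (1 + fps_X) ^ (?n - 1 - 2 * k) * (4 * fps_X) ^ k" for k
  let ?G = "\<lambda>\<tau>. Abs_fps (\<lambda>p. of_nat (card {f \<in> set \<tau> \<rightarrow>\<^sub>E {..<2 * p}. sorted_wrt (before f) \<tau>})) :: rat fps"
  have "Abs_fps (\<lambda>p. of_nat (card (enriched_maps (2 * p) (cyc \<pi>)))) = (\<Sum>\<tau>\<in>cyc \<pi>. ?G \<tau>)"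
    by (rule fps_ext) (simp add: card_enriched_maps_rotations[OF d] fps_sum_nth)
  also have "\<dots> = (\<Sum>k<?n. ?G (rotate k \<pi>))"
    by (rule sum.reindex_bij_betw[OF bij_betw_rotate_cyc[OF d assms(2)], symmetric])
  also have "\<dots> = (\<Sum>k<?n. L (lin_peaks (rotate k \<pi>)))"
    using linear_enriched_fps(2)[of "rotate _ \<pi>"] d assms(2)
    by (intro sum.cong refl) (simp add: L_def)
  also have "\<dots> = of_nat (2 * ?c) * L (?c - 1) + of_nat (?n - 2 * ?c) * L ?c"
    by (rule sum_rotations_lin_peaks(2)[OF assms(2)])
  also have "\<dots> = cpk_fps ?n ?c"
  proof -
    have c: "2 * ?c \<le> ?n" "1 \<le> ?n"
      using sum_rotations_lin_peaks(1)[OF assms(2)] assms(2) by (auto simp: Suc_le_eq)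
    have "of_nat (2 * ?c) * L (?c - 1) =
        of_nat ?c * (4 * fps_X) ^ ?c * (1 + fps_X) ^ (?n - 2 * ?c + 1) * geom ^ (?n + 1)"
    proof (cases ?c)
      case (Suc e)
      then have "?n - 1 - 2 * e = ?n - 2 * ?c + 1" using c by simp
      then show ?thesis using Suc unfolding L_def by (simp add: mult_ac)
    qed simp
    then show ?thesis unfolding cpk_fps_eq[OF c] by (simp add: L_def mult_ac)
  qed
  finally show ?thesis by (simp add: cpk_cyc)
qed

section \<open>The cyclic peak number and relative order\<close>

lemma standardize_nth_less_iff:
  assumes "i < length \<pi>" "j < length \<pi>"
  shows "standardize \<pi> ! i < standardize \<pi> ! j \<longleftrightarrow> \<pi> ! i < \<pi> ! j"
proof -
  let ?r = "\<lambda>a. card {b \<in> set \<pi>. b \<le> a}"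
  have mono: "?r a \<le> ?r b" if "a \<le> b" for a b
    using that by (intro card_mono) auto
  have strict: "?r a < ?r b" if "a < b" "b \<in> set \<pi>" for a b
  proof (rule psubset_card_mono)
    have "b \<in> {c \<in> set \<pi>. c \<le> b} - {c \<in> set \<pi>. c \<le> a}" using that by simp
    then show "{c \<in> set \<pi>. c \<le> a} \<subset> {c \<in> set \<pi>. c \<le> b}" using that by fastforce
  qed simp
  have "?r (\<pi> ! i) < ?r (\<pi> ! j) \<longleftrightarrow> \<pi> ! i < \<pi> ! j"
    using mono[of "\<pi> ! j" "\<pi> ! i"] strict[of "\<pi> ! i" "\<pi> ! j"] assms by (meson leD not_le nth_mem)
  then show ?thesis using assms by (simp add: standardize_def)
qed

lemma cyc_peak_standardize: "cyc_peak (standardize \<pi>) i \<longleftrightarrow> cyc_peak \<pi> i"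
proof (cases "i < length \<pi>")
  case True
  then have "(i + length \<pi> - 1) mod length \<pi> < length \<pi>" "(i + 1) mod length \<pi> < length \<pi>"
    by (auto intro!: mod_less_divisor)
  moreover have "length (standardize \<pi>) = length \<pi>" by (simp add: standardize_def)
  ultimately show ?thesis
    using True by (simp only: cyc_peak_def standardize_nth_less_iff)
qed (simp add: cyc_peak_def standardize_def)

lemma cyc_statistic_cpk: "cyc_statistic cpk"
proof -
  have "cpk_lin \<pi> = cpk_lin (standardize \<pi>)" for \<pi>
    by (simp add: cpk_lin_eq cyc_peak_standardize)
  then show ?thesis
    by (simp add: cyc_statistic_def cpk_cyc same_relative_order_def) metis
qed

lemma standardize_shift: "standardize (map (\<lambda>a. a + k) \<pi>) = standardize \<pi>"
proof -
  have "{b \<in> (\<lambda>a. a + k) ` set \<pi>. b \<le> a + k} = (\<lambda>a. a + k) ` {b \<in> set \<pi>. b \<le> a}" for a by auto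
  then show ?thesis by (simp add: standardize_def card_image)
qed

section \<open>The values of the cyclic peak number\<close>

definition cpk_values :: "nat \<Rightarrow> nat set" where
  "cpk_values n = (if n \<le> 1 then {0} else {1..n div 2})"

text \<open>
  For length at least 2 the largest letter is a peak, and no two cyclic neighbours are both peaks.
\<close>
lemma cpk_in_values:
  assumes "lin_perm \<pi>"
  shows "cpk (cyc \<pi>) \<in> cpk_values (length \<pi>)"
proof (cases "length \<pi> \<le> 1")
  case True
  then have "\<not> cyc_peak \<pi> i" for i by (cases "length \<pi>") (auto simp: cyc_peak_def)
  then show ?thesis using True by (simp add: cpk_values_def cpk_cyc cpk_lin_eq)
next
  case False
  let ?n = "length \<pi>"
  have ne: "\<pi> \<noteq> []" and n: "2 \<le> ?n" using False by auto
  have "Max (set \<pi>) \<in> set \<pi>" using ne by simp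
  then obtain i where i: "i < ?n" "\<pi> ! i = Max (set \<pi>)" by (metis in_set_conv_nth)
  have less: "\<pi> ! j < \<pi> ! i" if "j < ?n" "j \<noteq> i" for j
  proof -
    have "\<pi> ! j \<le> \<pi> ! i" using that i by simp
    moreover have "\<pi> ! j \<noteq> \<pi> ! i"
      using that i(1) assms by (simp add: lin_perm_def nth_eq_iff_index_eq)
    ultimately show ?thesis by simp
  qed
  have "(i + 1) mod ?n \<noteq> i" using i(1) n by (cases "i + 1 = ?n") auto
  moreover have "(i + ?n - 1) mod ?n \<noteq> i"
  proof (cases i)
    case (Suc j)
    then have "(i + ?n - 1) mod ?n = j" using i(1) by simp
    then show ?thesis using Suc by simp
  qed (use n in simp)
  moreover have "(i + 1) mod ?n < ?n" "(i + ?n - 1) mod ?n < ?n" using n by (auto intro!: mod_less_divisor)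
  ultimately have "cyc_peak \<pi> i" using i(1) less unfolding cyc_peak_def by blast
  then have "1 \<le> cpk_lin \<pi>"
    unfolding cpk_lin_eq using finite_cyc_peaks[of \<pi>] by (auto simp: Suc_le_eq card_gt_0_iff)
  moreover have "cpk_lin \<pi> \<le> ?n div 2" using sum_rotations_lin_peaks(1)[OF ne] by simp
  ultimately show ?thesis using False by (simp add: cpk_values_def cpk_cyc)
qed

text \<open>
  The word \<open>1, n, 2, n - 1, \<dots>, j, n - j + 1\<close> followed by the remaining letters in decreasing order; its
  peaks are the letters at the \<open>j\<close> odd positions below \<open>2j\<close>.
\<close>
definition zigzag :: "nat \<Rightarrow> nat \<Rightarrow> nat list" where
  "zigzag n j = map (\<lambda>i. if i < 2 * j then if even i then i div 2 + 1 else n - i div 2 else n + j - i) [0..<n]"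

lemma zigzag_props:
  assumes "1 \<le> j" "j \<le> n div 2"
  shows "lin_perm (zigzag n j)" "length (zigzag n j) = n" "cpk_lin (zigzag n j) = j"
proof -
  let ?v = "\<lambda>i. if i < 2 * j then if even i then i div 2 + 1 else n - i div 2 else n + j - i"
  have n: "2 * j \<le> n" using assms(2) by simp
  show len: "length (zigzag n j) = n" by (simp add: zigzag_def)
  have nth: "zigzag n j ! i = ?v i" if "i < n" for i using that by (simp add: zigzag_def)
  have even: "?v (2 * a) = a + 1" "?v (2 * a + 1) = n - a" if "a < j" for a using that by auto
  have cases: P if "\<And>a. i = 2 * a \<Longrightarrow> a < j \<Longrightarrow> P" "\<And>a. i = 2 * a + 1 \<Longrightarrow> a < j \<Longrightarrow> P"
    "2 * j \<le> i \<Longrightarrow> P" for i P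
    using that by (cases "2 * j \<le> i"; cases "even i") (auto elim!: evenE oddE)
  have inj: "inj_on ?v {..<n}"
  proof (rule inj_onI)
    fix i i' assume "i \<in> {..<n}" "i' \<in> {..<n}" "?v i = ?v i'"
    then show "i = i'"
      by (rule_tac cases[of i]; rule_tac cases[of i']) (use n in auto)
  qed
  have pos: "0 < ?v i" if "i < n" for i using that n assms(1) by auto
  show "lin_perm (zigzag n j)"
    unfolding lin_perm_def zigzag_def using inj pos by (auto simp: distinct_map atLeast0LessThan)
  have peak: "cyc_peak (zigzag n j) i \<longleftrightarrow> odd i \<and> i < 2 * j" if i: "i < n" for i
  proof (rule cases[of i])
    fix a assume e: "i = 2 * a" "a < j"
    have "i + 1 < n" using e n by simp
    then show ?thesis using e n i unfolding cyc_peak_def len by (auto simp: nth even)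
  next
    fix a assume o: "i = 2 * a + 1" "a < j"
    have p: "(i + n - 1) mod n = 2 * a" using o i by simp
    have "zigzag n j ! ((i + 1) mod n) < n - a"
    proof -
      \<comment> \<open>The next letter is a small one, the start of the decreasing tail, or the first letter.\<close>
      consider "a + 1 < j" | "a + 1 = j" "2 * j < n" | "a + 1 = j" "2 * j = n" using o n by linarith
      then show ?thesis
      proof cases
        case 1
        then have "(i + 1) mod n = 2 * (a + 1)" using o n by simp
        moreover have "2 * (a + 1) < n" using 1 n by simp
        ultimately show ?thesis using 1 n even(1)[of "a + 1"] nth[of "2 * (a + 1)"] by simp
      next
        case 2
        then have "(i + 1) mod n = 2 * j" using o by simp
        then show ?thesis using 2 nth[of "2 * j"] by simp
      next
        case 3
        then have "i + 1 = n" using o by simp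
        then have "(i + 1) mod n = 0" by simp
        then show ?thesis using 3 nth[of 0] by simp
      qed
    qed
    then show ?thesis using o n i p nth[of "2 * a"] nth[of i] even[of a] unfolding cyc_peak_def len by simp
  next
    assume t: "2 * j \<le> i"
    have "i + n - 1 = i - 1 + n" using t assms(1) by linarith
    then have p: "(i + n - 1) mod n = i - 1" using i by (simp only: mod_add_self2) simp
    have "zigzag n j ! i < zigzag n j ! (i - 1)"
    proof (cases "i = 2 * j")
      \<comment> \<open>The tail starts below the last large letter.\<close>
      case True
      obtain b where "j = Suc b" using assms(1) by (cases j) auto
      then show ?thesis using True i nth[of i] nth[of "2 * b + 1"] by simp
    next
      case False
      then have "\<not> i - 1 < 2 * j" using t by linarith
      then have "zigzag n j ! (i - 1) = n + j - (i - 1)" "zigzag n j ! i = n + j - i"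
        using i t nth[of "i - 1"] nth[of i] by simp_all
      then show ?thesis using t i assms(1) by linarith
    qed
    then show ?thesis using t p unfolding cyc_peak_def len by simp
  qed
  moreover have "i < n" if "cyc_peak (zigzag n j) i" for i using that by (simp add: cyc_peak_def len)
  ultimately have "{i. cyc_peak (zigzag n j) i} = {i. odd i \<and> i < 2 * j}" using n by fastforce
  also have "\<dots> = (\<lambda>a. 2 * a + 1) ` {..<j}" by (auto elim!: oddE)
  finally show "cpk_lin (zigzag n j) = j"
    unfolding cpk_lin_eq by (simp add: card_image inj_on_def)
qed

lemma cpk_values_attained:
  assumes "j \<in> cpk_values n"
  obtains \<pi> where "lin_perm \<pi>" "length \<pi> = n" "cpk (cyc \<pi>) = j"
proof (cases "n \<le> 1")
  case True
  then have "lin_perm [1..<Suc n]" "length [1..<Suc n] = n" by (auto simp: lin_perm_def)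
  then show ?thesis using that cpk_in_values[of "[1..<Suc n]"] True assms
    by (auto simp: cpk_values_def simp del: upt_Suc)
next
  case False
  then show ?thesis using that zigzag_props[of j n] assms by (auto simp: cpk_values_def cpk_cyc)
qed

section \<open>Linear independence and cyclic shuffle-compatibility\<close>

text \<open>
  The empty permutation is a separate case because \<open>cpk_fps 0 0\<close> is \<open>0\<close>.
\<close>
definition class_fps :: "nat \<Rightarrow> nat \<Rightarrow> rat fps" where
  "class_fps n j = (if n = 0 then 1 / (1 - fps_X) else cpk_fps n j)"

lemma class_fps_eq_enriched:
  assumes "lin_perm \<pi>"
  shows "class_fps (length \<pi>) (cpk (cyc \<pi>)) = Abs_fps (\<lambda>p. of_nat (card (enriched_maps (2 * p) (cyc \<pi>))))"
proof (cases "\<pi> = []")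
  case True
  have "cyc [] = {[]}" by (auto simp: cyc_def)
  then have "enriched_maps q (cyc []) = {\<lambda>_. undefined}" for q
    by (auto simp: enriched_maps_def)
  then show ?thesis using True
    by (simp add: class_fps_def fps_divide_unit fps_inverse_one_minus_fps_X)
qed (simp add: class_fps_def enriched_maps_fps[OF assms])

lemma class_fps_mult:
  assumes "lin_perm \<pi>" "lin_perm \<sigma>" "disjoint_perms \<pi> \<sigma>"
  shows "Abs_fps (\<lambda>p. class_fps (length \<pi>) (cpk (cyc \<pi>)) $ p * class_fps (length \<sigma>) (cpk (cyc \<sigma>)) $ p) =
         (\<Sum>T\<in>cSh (cyc \<pi>) (cyc \<sigma>). class_fps (length \<pi> + length \<sigma>) (cpk T))"
proof (rule fps_ext)
  fix p
  have T: "class_fps (length \<pi> + length \<sigma>) (cpk T) $ p = of_nat (card (enriched_maps (2 * p) T))"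
    if T: "T \<in> cSh (cyc \<pi>) (cyc \<sigma>)" for T
  proof -
    obtain \<tau> where t: "T = cyc \<tau>" "lin_perm \<tau>" "length \<tau> = length \<pi> + length \<sigma>"
      using cSh_E[OF T assms] by metis
    then show ?thesis using class_fps_eq_enriched[OF t(2)] by simp
  qed
  show "Abs_fps (\<lambda>p. class_fps (length \<pi>) (cpk (cyc \<pi>)) $ p * class_fps (length \<sigma>) (cpk (cyc \<sigma>)) $ p) $ p =
      (\<Sum>T\<in>cSh (cyc \<pi>) (cyc \<sigma>). class_fps (length \<pi> + length \<sigma>) (cpk T)) $ p"
    by (simp add: fps_sum_nth T class_fps_eq_enriched assms enriched_maps_mult[OF assms, symmetric]
        flip: of_nat_sum of_nat_mult)
qed

lemma cpk_fps_nth: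
  assumes "2 * j \<le> n" "1 \<le> n" "p \<le> j"
  shows "cpk_fps n j $ p = (if p = j then of_nat j * 4 ^ j else 0)"
proof -
  let ?G = "of_nat j * (1 + fps_X) ^ (n - 2 * j + 1) * geom ^ (n + 1)
    + fps_X * (2 * of_nat (n - 2 * j) * (1 + fps_X) ^ (n - 2 * j - 1) * geom ^ (n + 1)) :: rat fps"
  have c: "(4 ^ j :: rat fps) = fps_const (4 ^ j)" by (simp add: fps_const_power numeral_fps_const)
  have "cpk_fps n j = 4 ^ j * (fps_X ^ j * ?G)"
    unfolding cpk_fps_eq[OF assms(1,2)] by (simp add: algebra_simps power_mult_distrib)
  then have "cpk_fps n j $ p = 4 ^ j * (fps_X ^ j * ?G) $ p"
    unfolding c by simp
  also have "\<dots> = (if p = j then 4 ^ j * ?G $ 0 else 0)"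
    using assms(3) by (simp only: fps_X_power_mult_nth) auto
  also have "?G $ 0 = of_nat j" by (simp add: fps_nth_power_0)
  finally show ?thesis by (simp add: mult.commute)
qed

text \<open>
  For \<open>n \<ge> 2\<close> the \<open>j\<close>-th series starts with \<open>j 4^j t^j\<close>, so the coefficients of a relation vanish one after
  the other. For \<open>n \<le> 1\<close> there is a single series, which is not \<open>0\<close>.
\<close>
lemma class_fps_independent:
  assumes "finite S" "S \<subseteq> cpk_values n" "(\<Sum>j\<in>S. fps_const (c j) * class_fps n j) = 0" "j \<in> S"
  shows "c j = 0"
proof (cases "n \<le> 1")
  case True
  then have "S = {0}" "j = 0" using assms(2,4) by (auto simp: cpk_values_def)
  \<comment> \<open>The coefficient of \<open>t\<close> serves both \<open>1 / (1 - t)\<close> and \<open>2t / (1 - t)^2\<close>.\<close>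
  then have "c 0 * class_fps n 0 $ 1 = 0"
    using arg_cong[OF assms(3), of "\<lambda>F. F $ 1"] by simp
  moreover have "class_fps n 0 $ 1 \<noteq> 0"
  proof (cases "n = 0")
    case False
    then have "n = 1" using True by simp
    have "geom $ 0 = 1" by simp
    have "cpk_fps 1 0 = fps_X * (2 * geom ^ 2)"
      by (subst cpk_fps_eq) (simp_all add: power2_eq_square mult_ac)
    then have "cpk_fps 1 0 $ 1 = (2 * geom ^ 2) $ 0" by simp
    then show ?thesis using \<open>n = 1\<close> by (simp add: class_fps_def fps_nth_power_0)
  qed (simp add: class_fps_def fps_divide_unit fps_inverse_one_minus_fps_X)
  ultimately show ?thesis using \<open>j = 0\<close> by simp
next
  case False
  have val: "1 \<le> i" "2 * i \<le> n" if "i \<in> S" for i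
  proof -
    have "i \<in> {1..n div 2}" using that assms(2) False by (auto simp: cpk_values_def)
    then show "1 \<le> i" "2 * i \<le> n" by auto
  qed
  show ?thesis using assms(4)
  proof (induction j rule: less_induct)
    case (less j)
    have "0 = (\<Sum>i\<in>S. fps_const (c i) * class_fps n i) $ j" using assms(3) by simp
    also have "\<dots> = (\<Sum>i\<in>S. c i * cpk_fps n i $ j)"
      using False by (simp add: fps_sum_nth class_fps_def)
    also have "\<dots> = (\<Sum>i\<in>S. if i = j then c j * (of_nat j * 4 ^ j) else 0)"
    proof (rule sum.cong[OF refl])
      fix i assume "i \<in> S"
      then show "c i * cpk_fps n i $ j = (if i = j then c j * (of_nat j * 4 ^ j) else 0)"
        using less.IH[of i] cpk_fps_nth[of i n j] val[of i] False by (cases "i < j") auto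
    qed
    also have "\<dots> = c j * (of_nat j * 4 ^ j)" using assms(1) less.prems by simp
    finally show ?case using val[OF less.prems] by simp
  qed
qed

text \<open>
  The sum of the series over \<open>cSh [\<pi>] [\<sigma>]\<close> is a Hadamard product that depends on the classes of \<open>[\<pi>]\<close> and
  \<open>[\<sigma>]\<close> only. The multiplicities of the values of \<open>cpk\<close> are the coefficients of this sum with respect
  to independent series.
\<close>
theorem cyc_shuffle_compatible_cpk: "cyc_shuffle_compatible cpk"
  unfolding cyc_shuffle_compatible_def
proof (intro conjI allI impI cyc_statistic_cpk, elim conjE)
  fix \<pi> \<sigma> \<pi>' \<sigma>'
  assume a: "lin_perm \<pi>" "lin_perm \<sigma>" "disjoint_perms \<pi> \<sigma>"
    and a': "lin_perm \<pi>'" "lin_perm \<sigma>'" "disjoint_perms \<pi>' \<sigma>'"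
    and eq: "cpk (cyc \<pi>) = cpk (cyc \<pi>')" "cpk (cyc \<sigma>) = cpk (cyc \<sigma>')"
      "length \<pi> = length \<pi>'" "length \<sigma> = length \<sigma>'"
  let ?N = "length \<pi> + length \<sigma>"
  let ?m = "\<lambda>\<pi> \<sigma> j. card {T \<in> cSh (cyc \<pi>) (cyc \<sigma>). cpk T = j}"
  have J: "finite (cpk_values ?N)" by (simp add: cpk_values_def)
  have count: "count (image_mset cpk (mset_set (cSh (cyc \<alpha>) (cyc \<beta>)))) j = ?m \<alpha> \<beta> j"
    if "lin_perm \<alpha>" "lin_perm \<beta>" "disjoint_perms \<alpha> \<beta>" for \<alpha> \<beta> j
  proof -
    have "cpk -` {j} \<inter> cSh (cyc \<alpha>) (cyc \<beta>) = {T \<in> cSh (cyc \<alpha>) (cyc \<beta>). cpk T = j}" by auto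
    then show ?thesis using finite_cSh[OF that] by (simp add: count_image_mset)
  qed
  have vals: "cpk T \<in> cpk_values (length \<alpha> + length \<beta>)"
    if "T \<in> cSh (cyc \<alpha>) (cyc \<beta>)" "lin_perm \<alpha>" "lin_perm \<beta>" "disjoint_perms \<alpha> \<beta>" for T \<alpha> \<beta>
    using cSh_E[OF that] cpk_in_values by metis
  have sum: "(\<Sum>T\<in>cSh (cyc \<alpha>) (cyc \<beta>). class_fps ?N (cpk T)) =
      (\<Sum>j\<in>cpk_values ?N. fps_const (of_nat (?m \<alpha> \<beta> j)) * class_fps ?N j)"
    if "lin_perm \<alpha>" "lin_perm \<beta>" "disjoint_perms \<alpha> \<beta>" "?N = length \<alpha> + length \<beta>" for \<alpha> \<beta>
  proof -
    have "(\<Sum>T\<in>cSh (cyc \<alpha>) (cyc \<beta>). class_fps ?N (cpk T)) =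
      (\<Sum>j\<in>cpk_values ?N. \<Sum>T | T \<in> cSh (cyc \<alpha>) (cyc \<beta>) \<and> cpk T = j. class_fps ?N (cpk T))"
      using vals[OF _ that(1-3)] that(4) by (intro sum.group[symmetric] J finite_cSh[OF that(1-3)]) auto
    then show ?thesis by (simp add: fps_of_nat)
  qed
  have "(\<Sum>T\<in>cSh (cyc \<pi>) (cyc \<sigma>). class_fps ?N (cpk T)) = (\<Sum>T\<in>cSh (cyc \<pi>') (cyc \<sigma>'). class_fps ?N (cpk T))"
    using class_fps_mult[OF a] class_fps_mult[OF a'] eq by simp
  then have zero: "(\<Sum>j\<in>cpk_values ?N. fps_const (of_nat (?m \<pi> \<sigma> j) - of_nat (?m \<pi>' \<sigma>' j)) * class_fps ?N j) = 0"
    using sum[OF a] sum[OF a'] eq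
    by (simp add: sum_subtractf left_diff_distrib flip: fps_const_sub)
  show "image_mset cpk (mset_set (cSh (cyc \<pi>) (cyc \<sigma>))) = image_mset cpk (mset_set (cSh (cyc \<pi>') (cyc \<sigma>')))"
  proof (rule multiset_eqI)
    fix j
    have "?m \<pi> \<sigma> j = ?m \<pi>' \<sigma>' j"
    proof (cases "j \<in> cpk_values ?N")
      case True
      then show ?thesis using class_fps_independent[OF J order_refl zero] by simp
    next
      case False
      then have "{T \<in> cSh (cyc \<pi>) (cyc \<sigma>). cpk T = j} = {}" "{T \<in> cSh (cyc \<pi>') (cyc \<sigma>'). cpk T = j} = {}"
        using vals[OF _ a] vals[OF _ a'] eq by auto
      then show ?thesis by (simp only:)
    qed
    then show "count (image_mset cpk (mset_set (cSh (cyc \<pi>) (cyc \<sigma>)))) j =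
        count (image_mset cpk (mset_set (cSh (cyc \<pi>') (cyc \<sigma>')))) j"
      using count[OF a] count[OF a'] by simp
  qed
qed

section \<open>Realizing the cyclic shuffle algebra inside a commutative algebra\<close>

lemma cst_classes_E:
  assumes "C \<in> cst_classes cst"
  obtains \<pi> where "lin_perm \<pi>" "C = cst_class cst (cyc \<pi>)"
  using assms unfolding cst_classes_def cst_class_def by (auto elim!: quotientE)

lemma cst_class_in_classes: "lin_perm \<pi> \<Longrightarrow> cst_class cst (cyc \<pi>) \<in> cst_classes cst"
  unfolding cst_classes_def cst_class_def by (auto intro: quotientI)

lemma cst_class_eq_iff:
  assumes "lin_perm \<pi>" "lin_perm \<sigma>"
  shows "cst_class cst (cyc \<pi>) = cst_class cst (cyc \<sigma>) \<longleftrightarrow>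
    length \<pi> = length \<sigma> \<and> cst (cyc \<pi>) = cst (cyc \<sigma>)"
proof
  assume eq: "cst_class cst (cyc \<pi>) = cst_class cst (cyc \<sigma>)"
  have "cyc \<pi> \<in> cst_class cst (cyc \<pi>)" using assms(1) by (auto simp: cst_class_eq)
  then show "length \<pi> = length \<sigma> \<and> cst (cyc \<pi>) = cst (cyc \<sigma>)"
    unfolding eq cst_class_eq[OF assms(2)] by (auto dest: cyc_eq_length)
qed (simp add: cst_class_eq assms)

text \<open>
  Adding the same number to all letters keeps the relative order, so one of two representatives can be
  moved above the letters of the other.
\<close>
lemma disjoint_representatives:
  assumes "cyc_statistic cst" "C \<in> cst_classes cst" "D \<in> cst_classes cst"
  obtains \<pi> \<sigma> where "lin_perm \<pi>" "lin_perm \<sigma>" "disjoint_perms \<pi> \<sigma>"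
    "C = cst_class cst (cyc \<pi>)" "D = cst_class cst (cyc \<sigma>)"
proof -
  obtain \<pi> \<sigma> where p: "lin_perm \<pi>" "C = cst_class cst (cyc \<pi>)"
    and s: "lin_perm \<sigma>" "D = cst_class cst (cyc \<sigma>)"
    using assms(2,3) by (metis cst_classes_E)
  let ?\<sigma> = "map (\<lambda>a. a + sum_list \<pi>) \<sigma>"
  have s': "lin_perm ?\<sigma>" using s(1) by (auto simp: lin_perm_def distinct_map)
  moreover have "disjoint_perms \<pi> ?\<sigma>"
  proof -
    have "a < b + sum_list \<pi>" if "a \<in> set \<pi>" "b \<in> set \<sigma>" for a b
      using member_le_sum_list[OF that(1)] s(1) that(2) by (fastforce simp: lin_perm_def)
    then show ?thesis by (fastforce simp: disjoint_perms_def)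
  qed
  moreover have "cst (cyc ?\<sigma>) = cst (cyc \<sigma>)"
    using assms(1)[unfolded cyc_statistic_def, rule_format, of ?\<sigma> \<sigma>] s(1) s'
    by (simp add: same_relative_order_def standardize_shift)
  then have "cst_class cst (cyc ?\<sigma>) = D" using s s' by (simp add: cst_class_eq_iff)
  ultimately show ?thesis using that p by blast
qed

lemma cring_rat_ring: "cring rat_ring"
proof (rule cringI)
  show "abelian_group rat_ring"
    by (rule abelian_groupI) (auto simp: rat_ring_def intro: exI[of _ "- _"])
  show "Group.comm_monoid rat_ring"
    by (rule comm_monoidI) (auto simp: rat_ring_def)
qed (simp add: rat_ring_def distrib_right)

lemma algebra_restricted:
  fixes scale :: "rat \<Rightarrow> 'b::comm_ring_1 \<Rightarrow> 'b"
  assumes "vector_space scale" and scale_mult: "\<And>c x y. scale c x * y = scale c (x * y)"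
    and sub: "module.subspace scale V" and one: "1 \<in> V"
    and mult: "\<And>x y. x \<in> V \<Longrightarrow> y \<in> V \<Longrightarrow> x * y \<in> V"
  shows "algebra rat_ring (restricted_algebra scale V)"
proof -
  interpret vector_space scale by fact
  note closed = subspace_0[OF sub] subspace_add[OF sub] subspace_scale[OF sub] subspace_neg[OF sub]
  show ?thesis
  proof (rule algebraI[OF cring_rat_ring])
    show "cring (restricted_algebra scale V)"
    proof (rule cringI)
      show "abelian_group (restricted_algebra scale V)"
      proof (rule abelian_groupI)
        fix x assume "x \<in> carrier (restricted_algebra scale V)"
        then show "\<exists>y\<in>carrier (restricted_algebra scale V).
            y \<oplus>\<^bsub>restricted_algebra scale V\<^esub> x = \<zero>\<^bsub>restricted_algebra scale V\<^esub>"
          using closed(4) by (intro bexI[of _ "- x"]) (auto simp: restricted_algebra_def)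
      qed (auto simp: restricted_algebra_def closed add_ac)
      show "Group.comm_monoid (restricted_algebra scale V)"
        by (rule comm_monoidI) (auto simp: restricted_algebra_def one mult mult_ac)
    qed (simp add: restricted_algebra_def distrib_right)
  qed (auto simp: restricted_algebra_def rat_ring_def closed scale_mult
        scale_left_distrib scale_right_distrib)
qed

text \<open>
  A value for every class such that the values are linearly independent and multiply in a commutative
  algebra as the classes do. The linear extension then embeds the cyclic shuffle algebra.
\<close>
locale cyc_algebra_realization = vector_space scale
  for scale :: "rat \<Rightarrow> 'b::comm_ring_1 \<Rightarrow> 'b" +
  fixes cst :: "nat list set \<Rightarrow> 'a" and val :: "nat list set set \<Rightarrow> 'b"
  assumes scale_mult: "\<And>c x y. scale c x * y = scale c (x * y)"
    and compatible: "cyc_shuffle_compatible cst"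
    and val_one: "val (cst_class cst (cyc [])) = 1"
    and val_mult: "\<And>\<pi> \<sigma>. \<lbrakk>lin_perm \<pi>; lin_perm \<sigma>; disjoint_perms \<pi> \<sigma>\<rbrakk> \<Longrightarrow>
      val (cst_class cst (cyc \<pi>)) * val (cst_class cst (cyc \<sigma>)) =
      (\<Sum>T\<in>cSh (cyc \<pi>) (cyc \<sigma>). val (cst_class cst T))"
    and val_independent: "\<And>S c C. \<lbrakk>finite S; S \<subseteq> cst_classes cst; (\<Sum>C\<in>S. scale (c C) (val C)) = 0; C \<in> S\<rbrakk>
      \<Longrightarrow> c C = 0"
begin

definition extension :: "cyc_vec \<Rightarrow> 'b" where
  "extension f = (\<Sum>C\<in>Poly_Mapping.keys f. scale (Poly_Mapping.lookup f C) (val C))"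

abbreviation vecs :: "cyc_vec set" where
  "vecs \<equiv> {f. Poly_Mapping.keys f \<subseteq> cst_classes cst}"

lemma extension_superset:
  assumes "finite S" "Poly_Mapping.keys f \<subseteq> S"
  shows "extension f = (\<Sum>C\<in>S. scale (Poly_Mapping.lookup f C) (val C))"
  unfolding extension_def using assms
  by (intro sum.mono_neutral_left) (auto simp: in_keys_iff)

lemma extension_add: "extension (f + g) = extension f + extension g"
proof -
  let ?S = "Poly_Mapping.keys f \<union> Poly_Mapping.keys g"
  have "finite ?S" "Poly_Mapping.keys (f + g) \<subseteq> ?S" by (auto dest: subsetD[OF Poly_Mapping.keys_add])
  then show ?thesis
    using extension_superset[of ?S] by (simp add: lookup_add scale_left_distrib sum.distrib)
qed

lemma extension_scale: "extension (scale_vec c f) = scale c (extension f)"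
proof -
  have "Poly_Mapping.keys (scale_vec c f) \<subseteq> Poly_Mapping.keys f"
    by (auto simp: in_keys_iff lookup_scale_vec)
  then show ?thesis
    using extension_superset[of "Poly_Mapping.keys f"]
    by (simp add: lookup_scale_vec scale_sum_right)
qed

lemma extension_zero: "extension 0 = 0"
  by (simp add: extension_def)

lemma extension_sum: "extension (\<Sum>i\<in>I. F i) = (\<Sum>i\<in>I. extension (F i))"
  by (induction I rule: infinite_finite_induct) (simp_all add: extension_zero extension_add)

lemma extension_basis: "extension (cst_basis cst P) = val (cst_class cst P)"
  by (simp add: extension_def cst_basis_def)

lemma inj_on_extension: "inj_on extension vecs"
proof (rule inj_onI)
  fix f g assume fg: "f \<in> vecs" "g \<in> vecs" "extension f = extension g"
  let ?S = "Poly_Mapping.keys f \<union> Poly_Mapping.keys g"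
  have "(\<Sum>C\<in>?S. scale (Poly_Mapping.lookup f C - Poly_Mapping.lookup g C) (val C)) = 0"
    using fg(3) extension_superset[of ?S f] extension_superset[of ?S g]
    by (simp add: scale_left_diff_distrib sum_subtractf)
  then have "Poly_Mapping.lookup f C - Poly_Mapping.lookup g C = 0" if "C \<in> ?S" for C
    using val_independent[of ?S "\<lambda>C. Poly_Mapping.lookup f C - Poly_Mapping.lookup g C" C] fg(1,2) that
    by simp
  then have "Poly_Mapping.lookup f C = Poly_Mapping.lookup g C" for C
    by (cases "C \<in> ?S") (auto simp: in_keys_iff)
  then show "f = g" by (rule poly_mapping_eqI)
qed

lemma subspace_vecs: "cyc_vec.subspace vecs"
proof (rule cyc_vec.subspaceI)
  show "f + g \<in> vecs" if "f \<in> vecs" "g \<in> vecs" for f g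
    using that by (auto dest!: subsetD[OF Poly_Mapping.keys_add])
  show "scale_vec c f \<in> vecs" if "f \<in> vecs" for c f
    using that by (auto simp: in_keys_iff lookup_scale_vec subset_iff)
qed simp

lemma basis_in_vecs: "lin_perm \<pi> \<Longrightarrow> cst_basis cst (cyc \<pi>) \<in> vecs"
  by (simp add: cst_basis_def cst_class_in_classes)

text \<open>
  The product of two classes is defined by a choice of disjoint representatives; compatibility makes it the sum
  over the cyclic shuffles of any such pair.
\<close>
lemma class_mult_realized:
  assumes "C \<in> cst_classes cst" "D \<in> cst_classes cst"
  shows "class_mult cst C D \<in> vecs" "extension (class_mult cst C D) = val C * val D"
proof -
  have "cyc_statistic cst" using compatible by (simp add: cyc_shuffle_compatible_def)
  then obtain \<pi> \<sigma> where p: "lin_perm \<pi>" "lin_perm \<sigma>" "disjoint_perms \<pi> \<sigma>"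
    and CD: "C = cst_class cst (cyc \<pi>)" "D = cst_class cst (cyc \<sigma>)"
    using disjoint_representatives assms by metis
  have "class_mult cst C D = cst_mult cst (cst_basis cst (cyc \<pi>)) (cst_basis cst (cyc \<sigma>))"
    by (simp add: CD cst_mult_def cst_basis_def)
  then have eq: "class_mult cst C D = (\<Sum>T\<in>cSh (cyc \<pi>) (cyc \<sigma>). cst_basis cst T)"
    using cst_mult_basis[OF compatible p] by simp
  show "class_mult cst C D \<in> vecs"
    unfolding eq
  proof (rule cyc_vec.subspace_sum[OF subspace_vecs])
    fix T assume "T \<in> cSh (cyc \<pi>) (cyc \<sigma>)"
    then show "cst_basis cst T \<in> vecs" using basis_in_vecs cSh_E[OF _ p] by metis
  qed
  have "extension (class_mult cst C D) = (\<Sum>T\<in>cSh (cyc \<pi>) (cyc \<sigma>). val (cst_class cst T))"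
    by (simp only: eq extension_sum extension_basis)
  also have "\<dots> = val C * val D" by (simp only: CD val_mult[OF p])
  finally show "extension (class_mult cst C D) = val C * val D" .
qed

lemma mult_in_vecs:
  assumes "f \<in> vecs" "g \<in> vecs"
  shows "cst_mult cst f g \<in> vecs"
  unfolding cst_mult_def
  using assms class_mult_realized(1)
  by (intro cyc_vec.subspace_sum[OF subspace_vecs] cyc_vec.subspace_scale[OF subspace_vecs]) blast

lemma extension_mult:
  assumes "f \<in> vecs" "g \<in> vecs"
  shows "extension (cst_mult cst f g) = extension f * extension g"
proof -
  have scale_scale_mult: "scale a x * scale b y = scale (a * b) (x * y)" for a b x y
    using scale_mult[of a x "scale b y"] scale_mult[of b y x] by (simp add: mult.commute)
  have "extension (cst_mult cst f g) = (\<Sum>C\<in>Poly_Mapping.keys f. \<Sum>D\<in>Poly_Mapping.keys g.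
      scale (Poly_Mapping.lookup f C * Poly_Mapping.lookup g D) (val C * val D))"
    unfolding cst_mult_def extension_sum extension_scale
    using assms class_mult_realized(2) by (intro sum.cong refl arg_cong2[of _ _ _ _ scale]) blast
  also have "\<dots> = extension f * extension g"
    unfolding extension_def sum_product scale_scale_mult ..
  finally show ?thesis .
qed

lemma image_extension: "extension ` vecs = span (val ` cst_classes cst)"
proof
  show "extension ` vecs \<subseteq> span (val ` cst_classes cst)"
  proof (rule image_subsetI)
    fix f assume "f \<in> vecs"
    then show "extension f \<in> span (val ` cst_classes cst)"
      unfolding extension_def by (intro span_sum span_scale span_base imageI) blast
  qed
  show "span (val ` cst_classes cst) \<subseteq> extension ` vecs"
  proof (rule span_minimal)
    show "val ` cst_classes cst \<subseteq> extension ` vecs"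
    proof (rule image_subsetI)
      fix C assume "C \<in> cst_classes cst"
      then obtain \<pi> where "lin_perm \<pi>" "C = cst_class cst (cyc \<pi>)" by (rule cst_classes_E)
      then show "val C \<in> extension ` vecs"
        using basis_in_vecs extension_basis by (metis imageI)
    qed
    show "subspace (extension ` vecs)"
    proof (rule subspaceI)
      show "0 \<in> extension ` vecs"
        using extension_zero cyc_vec.subspace_0[OF subspace_vecs] by (metis imageI)
      show "x + y \<in> extension ` vecs" if "x \<in> extension ` vecs" "y \<in> extension ` vecs" for x y
        using that extension_add cyc_vec.subspace_add[OF subspace_vecs] by (smt (verit) imageE imageI)
      show "scale c x \<in> extension ` vecs" if "x \<in> extension ` vecs" for c x
        using that extension_scale cyc_vec.subspace_scale[OF subspace_vecs] by (smt (verit) imageE imageI)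
    qed
  qed
qed

lemma one_in_vecs: "cst_basis cst (cyc []) \<in> vecs"
  by (rule basis_in_vecs) (simp add: lin_perm_def)

lemma extension_one: "extension (cst_basis cst (cyc [])) = 1"
  by (simp add: extension_basis val_one)

text \<open>
  Each law of the algebra that involves the product is an equation between two vectors with the same image
  under the injective extension, because it holds in the target.
\<close>
lemma algebra_cyc_algebra: "algebra rat_ring (cyc_algebra cst)"
proof -
  note closed = mult_in_vecs one_in_vecs cyc_vec.subspace_0[OF subspace_vecs]
    cyc_vec.subspace_add[OF subspace_vecs] cyc_vec.subspace_scale[OF subspace_vecs]
  note ext = extension_mult extension_add extension_scale extension_one
  have eqI: "f = g" if "extension f = extension g" "f \<in> vecs" "g \<in> vecs" for f g
    using that inj_on_extension by (meson inj_onD)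
  show ?thesis
  proof (rule algebraI[OF cring_rat_ring])
    show "cring (cyc_algebra cst)"
    proof (rule cringI)
      show "abelian_group (cyc_algebra cst)"
      proof (rule abelian_groupI)
        fix f assume "f \<in> carrier (cyc_algebra cst)"
        then show "\<exists>g\<in>carrier (cyc_algebra cst). g \<oplus>\<^bsub>cyc_algebra cst\<^esub> f = \<zero>\<^bsub>cyc_algebra cst\<^esub>"
          using cyc_vec.subspace_neg[OF subspace_vecs, of f]
          by (intro bexI[of _ "- f"]) (auto simp: cyc_algebra_def)
      next
        fix f g assume "f \<in> carrier (cyc_algebra cst)" "g \<in> carrier (cyc_algebra cst)"
        then show "f \<oplus>\<^bsub>cyc_algebra cst\<^esub> g \<in> carrier (cyc_algebra cst)"
          using closed(4) by (simp add: cyc_algebra_def)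
      qed (auto simp: cyc_algebra_def add_ac)
      show "Group.comm_monoid (cyc_algebra cst)"
      proof (rule comm_monoidI)
        fix f g h
        assume "f \<in> carrier (cyc_algebra cst)" "g \<in> carrier (cyc_algebra cst)" "h \<in> carrier (cyc_algebra cst)"
        then have "f \<in> vecs" "g \<in> vecs" "h \<in> vecs" by (simp_all add: cyc_algebra_def)
        then have "cst_mult cst (cst_mult cst f g) h = cst_mult cst f (cst_mult cst g h)"
          by (intro eqI) (simp_all only: closed ext mult.assoc)
        then show "f \<otimes>\<^bsub>cyc_algebra cst\<^esub> g \<otimes>\<^bsub>cyc_algebra cst\<^esub> h =
            f \<otimes>\<^bsub>cyc_algebra cst\<^esub> (g \<otimes>\<^bsub>cyc_algebra cst\<^esub> h)"
          by (simp add: cyc_algebra_def)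
      next
        fix f g assume "f \<in> carrier (cyc_algebra cst)" "g \<in> carrier (cyc_algebra cst)"
        then have v: "f \<in> vecs" "g \<in> vecs" by (simp_all add: cyc_algebra_def)
        then show "f \<otimes>\<^bsub>cyc_algebra cst\<^esub> g \<in> carrier (cyc_algebra cst)"
          using closed(1) by (simp add: cyc_algebra_def)
        have "cst_mult cst f g = cst_mult cst g f"
          using v by (intro eqI) (simp_all only: closed ext mult.commute)
        then show "f \<otimes>\<^bsub>cyc_algebra cst\<^esub> g = g \<otimes>\<^bsub>cyc_algebra cst\<^esub> f"
          by (simp add: cyc_algebra_def)
      next
        fix f assume "f \<in> carrier (cyc_algebra cst)"
        then have "f \<in> vecs" by (simp add: cyc_algebra_def)
        then have "cst_mult cst (cst_basis cst (cyc [])) f = f"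
          by (intro eqI) (simp_all only: closed ext mult_1_left)
        then show "\<one>\<^bsub>cyc_algebra cst\<^esub> \<otimes>\<^bsub>cyc_algebra cst\<^esub> f = f"
          by (simp add: cyc_algebra_def)
      qed (use closed(2) in \<open>simp add: cyc_algebra_def\<close>)
      fix f g h
      assume "f \<in> carrier (cyc_algebra cst)" "g \<in> carrier (cyc_algebra cst)" "h \<in> carrier (cyc_algebra cst)"
      then have "f \<in> vecs" "g \<in> vecs" "h \<in> vecs" by (simp_all add: cyc_algebra_def)
      then have "cst_mult cst (f + g) h = cst_mult cst f h + cst_mult cst g h"
        by (intro eqI) (simp_all only: closed ext distrib_right)
      then show "(f \<oplus>\<^bsub>cyc_algebra cst\<^esub> g) \<otimes>\<^bsub>cyc_algebra cst\<^esub> h =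
          f \<otimes>\<^bsub>cyc_algebra cst\<^esub> h \<oplus>\<^bsub>cyc_algebra cst\<^esub> g \<otimes>\<^bsub>cyc_algebra cst\<^esub> h"
        by (simp add: cyc_algebra_def)
    qed
  next
    fix c f assume "f \<in> carrier (cyc_algebra cst)"
    then show "c \<odot>\<^bsub>cyc_algebra cst\<^esub> f \<in> carrier (cyc_algebra cst)"
      using closed(5) by (simp add: cyc_algebra_def)
  next
    fix c f g assume "f \<in> carrier (cyc_algebra cst)" "g \<in> carrier (cyc_algebra cst)"
    then have "f \<in> vecs" "g \<in> vecs" by (simp_all add: cyc_algebra_def)
    then have "cst_mult cst (scale_vec c f) g = scale_vec c (cst_mult cst f g)"
      by (intro eqI) (simp_all only: closed ext scale_mult)
    then show "(c \<odot>\<^bsub>cyc_algebra cst\<^esub> f) \<otimes>\<^bsub>cyc_algebra cst\<^esub> g =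
        c \<odot>\<^bsub>cyc_algebra cst\<^esub> (f \<otimes>\<^bsub>cyc_algebra cst\<^esub> g)"
      by (simp add: cyc_algebra_def)
  qed (simp_all add: cyc_algebra_def rat_ring_def cyc_vec.scale_left_distrib cyc_vec.scale_right_distrib)
qed

theorem algebra_iso_extension:
  "algebra_iso (cyc_algebra cst) (restricted_algebra scale (span (val ` cst_classes cst))) extension"
proof -
  have "vector_space scale" ..
  moreover have "1 \<in> span (val ` cst_classes cst)"
    using one_in_vecs extension_one image_extension by (metis imageI)
  moreover have "x * y \<in> span (val ` cst_classes cst)"
    if "x \<in> span (val ` cst_classes cst)" "y \<in> span (val ` cst_classes cst)" for x y
    using that mult_in_vecs extension_mult unfolding image_extension[symmetric]
    by (smt (verit) imageE imageI)
  ultimately have "algebra rat_ring (restricted_algebra scale (span (val ` cst_classes cst)))"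
    using scale_mult subspace_span by (intro algebra_restricted) auto
  moreover have "extension \<in> ring_iso (cyc_algebra cst) (restricted_algebra scale (span (val ` cst_classes cst)))"
  proof (rule ring_iso_memI)
    show "bij_betw extension (carrier (cyc_algebra cst))
        (carrier (restricted_algebra scale (span (val ` cst_classes cst))))"
      using inj_on_extension image_extension
      by (simp add: bij_betw_def cyc_algebra_def restricted_algebra_def)
    show "extension f \<in> carrier (restricted_algebra scale (span (val ` cst_classes cst)))"
      if "f \<in> carrier (cyc_algebra cst)" for f
      using that image_extension by (auto simp: cyc_algebra_def restricted_algebra_def)
  qed (simp_all add: cyc_algebra_def restricted_algebra_def extension_mult extension_add extension_one)
  ultimately show ?thesis
    using algebra_cyc_algebra extension_scale
    by (simp add: algebra_iso_def) (simp add: cyc_algebra_def restricted_algebra_def)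
qed

end

section \<open>The cyclic peak algebra\<close>

text \<open>
  Series placed in degree \<open>n\<close> of an algebra, such that the degrees form a direct sum and the
  product is the Hadamard product of series. Both targets of the theorem have this form, with \<open>t^p\<close>
  as a power of the variable or as the point \<open>p\<close>.
\<close>
locale graded_fps_embedding = vector_space scale
  for scale :: "rat \<Rightarrow> 'b::comm_ring_1 \<Rightarrow> 'b" +
  fixes emb :: "nat \<Rightarrow> rat fps \<Rightarrow> 'b"
  assumes scale_mult: "\<And>c x y. scale c x * y = scale c (x * y)"
    and emb_add: "\<And>n F G. emb n (F + G) = emb n F + emb n G"
    and emb_scale: "\<And>n c F. emb n (fps_const c * F) = scale c (emb n F)"
    and emb_mult: "\<And>m n F G. emb m F * emb n G = emb (m + n) (Abs_fps (\<lambda>p. F $ p * G $ p))"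
    and emb_one: "emb 0 (1 / (1 - fps_X)) = 1"
    and emb_direct: "\<And>N F n. \<lbrakk>finite N; (\<Sum>n\<in>N. emb n (F n)) = 0; n \<in> N\<rbrakk> \<Longrightarrow> F n = 0"
begin

lemma emb_sum: "emb n (\<Sum>i\<in>I. F i) = (\<Sum>i\<in>I. emb n (F i))"
proof -
  have "emb n 0 = 0" using emb_scale[of n 0 0] by simp
  then show ?thesis by (induction I rule: infinite_finite_induct) (simp_all add: emb_add)
qed

definition representative :: "nat list set set \<Rightarrow> nat list" where
  "representative C = (SOME \<pi>. lin_perm \<pi> \<and> C = cst_class cpk (cyc \<pi>))"

definition class_value :: "nat list set set \<Rightarrow> 'b" where
  "class_value C = (let \<pi> = representative C in emb (length \<pi>) (class_fps (length \<pi>) (cpk (cyc \<pi>))))"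

lemma representative:
  assumes "C \<in> cst_classes cpk"
  shows "lin_perm (representative C)" "cst_class cpk (cyc (representative C)) = C"
proof -
  have "\<exists>\<pi>. lin_perm \<pi> \<and> C = cst_class cpk (cyc \<pi>)" using cst_classes_E[OF assms] by blast
  then have "lin_perm (representative C) \<and> C = cst_class cpk (cyc (representative C))"
    unfolding representative_def by (rule someI_ex)
  then show "lin_perm (representative C)" "cst_class cpk (cyc (representative C)) = C" by simp_all
qed

lemma class_value_cyc:
  assumes "lin_perm \<pi>"
  shows "class_value (cst_class cpk (cyc \<pi>)) = emb (length \<pi>) (class_fps (length \<pi>) (cpk (cyc \<pi>)))"
proof -
  let ?r = "representative (cst_class cpk (cyc \<pi>))"
  note r = representative[OF cst_class_in_classes[OF assms, of cpk]]
  have "length ?r = length \<pi>" "cpk (cyc ?r) = cpk (cyc \<pi>)"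
    using r(2) unfolding cst_class_eq_iff[OF r(1) assms] by simp_all
  then show ?thesis by (simp add: class_value_def)
qed

text \<open>
  The degrees are independent by assumption, which reduces a relation to the classes of one length \<open>n\<close>.
  These are distinguished by \<open>cpk\<close>, so the independence of the series for fixed \<open>n\<close> applies.
\<close>
lemma class_value_independent:
  assumes S: "finite S" "S \<subseteq> cst_classes cpk" and zero: "(\<Sum>C\<in>S. scale (c C) (class_value C)) = 0"
    and C: "C \<in> S"
  shows "c C = 0"
proof -
  let ?len = "\<lambda>C. length (representative C)" and ?pk = "\<lambda>C. cpk (cyc (representative C))"
  let ?S = "\<lambda>n. {D \<in> S. ?len D = n}"
  define F where "F n = (\<Sum>D\<in>?S n. fps_const (c D) * class_fps n (?pk D))" for n
  have "(\<Sum>n\<in>?len ` S. emb n (F n)) = (\<Sum>n\<in>?len ` S. \<Sum>D\<in>?S n. scale (c D) (class_value D))"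
    unfolding F_def emb_sum emb_scale by (intro sum.cong refl) (simp add: class_value_def)
  also have "\<dots> = 0"
    unfolding sum.image_gen[OF S(1), of "\<lambda>D. scale (c D) (class_value D)" ?len, symmetric] by (rule zero)
  finally have "(\<Sum>D\<in>?S (?len C). fps_const (c D) * class_fps (?len C) (?pk D)) = 0"
    using emb_direct[of "?len ` S" F "?len C"] S(1) C by (simp add: F_def)
  moreover have inj: "inj_on ?pk (?S (?len C))"
  proof (rule inj_onI)
    fix D E assume DE: "D \<in> ?S (?len C)" "E \<in> ?S (?len C)" "?pk D = ?pk E"
    then have mem: "D \<in> cst_classes cpk" "E \<in> cst_classes cpk" using S(2) by auto
    have "cst_class cpk (cyc (representative D)) = cst_class cpk (cyc (representative E))"
      using DE cst_class_eq_iff[OF representative(1)[OF mem(1)] representative(1)[OF mem(2)], of cpk] by simp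
    then show "D = E" using representative(2)[OF mem(1)] representative(2)[OF mem(2)] by simp
  qed
  let ?c = "\<lambda>j. c (the_inv_into (?S (?len C)) ?pk j)"
  have "(\<Sum>j\<in>?pk ` ?S (?len C). fps_const (?c j) * class_fps (?len C) j) =
      (\<Sum>D\<in>?S (?len C). fps_const (c D) * class_fps (?len C) (?pk D))"
    unfolding sum.reindex[OF inj] comp_def
    by (rule sum.cong[OF refl]) (simp only: the_inv_into_f_f[OF inj])
  ultimately have "(\<Sum>j\<in>?pk ` ?S (?len C). fps_const (?c j) * class_fps (?len C) j) = 0" by simp
  moreover have "?pk ` ?S (?len C) \<subseteq> cpk_values (?len C)"
  proof (rule image_subsetI)
    fix D assume D: "D \<in> ?S (?len C)"
    then have "D \<in> cst_classes cpk" using S(2) by auto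
    then show "?pk D \<in> cpk_values (?len C)"
      using cpk_in_values[OF representative(1)] D by fastforce
  qed
  ultimately have "?c (?pk C) = 0"
    using class_fps_independent[of "?pk ` ?S (?len C)" "?len C" ?c "?pk C"] S(1) C by simp
  then show ?thesis using the_inv_into_f_f[OF inj, of C] C by simp
qed

sublocale cyc_algebra_realization scale cpk class_value
proof
  show "scale c x * y = scale c (x * y)" for c x y by (rule scale_mult)
  show "cyc_shuffle_compatible cpk" by (rule cyc_shuffle_compatible_cpk)
  have nil: "lin_perm []" by (simp add: lin_perm_def)
  show "class_value (cst_class cpk (cyc [])) = 1"
    using class_value_cyc[OF nil] by (simp add: class_fps_def emb_one)
  show "class_value (cst_class cpk (cyc \<pi>)) * class_value (cst_class cpk (cyc \<sigma>)) =
      (\<Sum>T\<in>cSh (cyc \<pi>) (cyc \<sigma>). class_value (cst_class cpk T))"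
    if p: "lin_perm \<pi>" "lin_perm \<sigma>" "disjoint_perms \<pi> \<sigma>" for \<pi> \<sigma>
  proof -
    have T: "class_value (cst_class cpk T) = emb (length \<pi> + length \<sigma>) (class_fps (length \<pi> + length \<sigma>) (cpk T))"
      if "T \<in> cSh (cyc \<pi>) (cyc \<sigma>)" for T
      using cSh_E[OF that p] class_value_cyc by metis
    show ?thesis
      unfolding class_value_cyc[OF p(1)] class_value_cyc[OF p(2)] emb_mult class_fps_mult[OF p] emb_sum
      by (rule sum.cong[OF refl]) (simp add: T)
  qed
  show "c C = 0" if "finite S" "S \<subseteq> cst_classes cpk" "(\<Sum>C\<in>S. scale (c C) (class_value C)) = 0" "C \<in> S"
    for S c C using class_value_independent[OF that] .
qed

lemma class_value_image:
  "class_value ` cst_classes cpk = {emb n (class_fps n j) |n j. j \<in> cpk_values n}"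
proof
  show "class_value ` cst_classes cpk \<subseteq> {emb n (class_fps n j) |n j. j \<in> cpk_values n}"
  proof (rule image_subsetI)
    fix C assume "C \<in> cst_classes cpk"
    then obtain \<pi> where "lin_perm \<pi>" "C = cst_class cpk (cyc \<pi>)" by (rule cst_classes_E)
    then show "class_value C \<in> {emb n (class_fps n j) |n j. j \<in> cpk_values n}"
      using cpk_in_values class_value_cyc by blast
  qed
  show "{emb n (class_fps n j) |n j. j \<in> cpk_values n} \<subseteq> class_value ` cst_classes cpk"
  proof clarify
    fix n j assume "j \<in> cpk_values n"
    then obtain \<pi> where "lin_perm \<pi>" "length \<pi> = n" "cpk (cyc \<pi>) = j" by (rule cpk_values_attained)
    then show "emb n (class_fps n j) \<in> class_value ` cst_classes cpk"
      using cst_class_in_classes class_value_cyc by (metis imageI)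
  qed
qed

theorem cpk_algebra_iso:
  "\<exists>\<phi>. (\<forall>\<pi>. lin_perm \<pi> \<longrightarrow> \<phi> (cst_basis cpk (cyc \<pi>)) = emb (length \<pi>) (class_fps (length \<pi>) (cpk (cyc \<pi>)))) \<and>
    algebra_iso (cyc_algebra cpk)
      (restricted_algebra scale (span {emb n (class_fps n j) |n j. j \<in> cpk_values n})) \<phi>"
  using algebra_iso_extension class_value_cyc extension_basis
  unfolding class_value_image by (intro exI[of _ extension]) simp

end

text \<open>
  The classes of length \<open>n\<close> correspond to the values of \<open>cpk\<close>, and the unit vectors of different classes
  are independent.
\<close>
theorem dim_homogeneous_component_cpk:
  "cyc_vec.dim (homogeneous_component cpk n) = card (cpk_values n)"
proof -
  have "\<exists>r. \<forall>j\<in>cpk_values n. lin_perm (r j) \<and> length (r j) = n \<and> cpk (cyc (r j)) = j"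
    by (rule bchoice) (metis cpk_values_attained)
  then obtain r where r: "\<And>j. j \<in> cpk_values n \<Longrightarrow> lin_perm (r j) \<and> length (r j) = n \<and> cpk (cyc (r j)) = j"
    by blast
  define C where "C j = cst_class cpk (cyc (r j))" for j
  have basis: "cst_basis cpk (cyc (r j)) = Poly_Mapping.single (C j) 1" for j
    by (simp add: cst_basis_def C_def)
  let ?b = "\<lambda>j. Poly_Mapping.single (C j) (1 :: rat)"
  let ?J = "cpk_values n"
  have J: "finite ?J" by (simp add: cpk_values_def)
  have C_inj: "inj_on C ?J"
  proof (rule inj_onI)
    fix i j assume "i \<in> ?J" "j \<in> ?J" "C i = C j"
    then show "i = j" using r[of i] r[of j] cst_class_eq_iff[of "r i" "r j" cpk] by (simp add: C_def)
  qed
  have "Poly_Mapping.single k (1 :: rat) = Poly_Mapping.single l 1 \<Longrightarrow> k = l" for k l :: "nat list set set"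
    by (metis keys_single singleton_inject one_neq_zero)
  then have b_inj: "inj_on ?b ?J" using C_inj by (metis (mono_tags, lifting) inj_on_def)
  have "{cst_basis cpk (cyc \<pi>) |\<pi>. lin_perm \<pi> \<and> length \<pi> = n} = ?b ` ?J"
  proof
    show "?b ` ?J \<subseteq> {cst_basis cpk (cyc \<pi>) |\<pi>. lin_perm \<pi> \<and> length \<pi> = n}"
      using r basis by (metis (mono_tags, lifting) image_subsetI mem_Collect_eq)
    show "{cst_basis cpk (cyc \<pi>) |\<pi>. lin_perm \<pi> \<and> length \<pi> = n} \<subseteq> ?b ` ?J"
    proof clarify
      fix \<pi> assume p: "lin_perm \<pi>" "n = length \<pi>"
      let ?j = "cpk (cyc \<pi>)"
      have j: "?j \<in> ?J" using cpk_in_values[OF p(1)] p(2) by simp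
      have "cst_class cpk (cyc \<pi>) = C ?j"
        unfolding C_def using r[OF j] p cst_class_eq_iff[of \<pi> "r ?j" cpk] by simp
      then show "cst_basis cpk (cyc \<pi>) \<in> ?b ` cpk_values (length \<pi>)"
        using j p(2) by (simp add: cst_basis_def)
    qed
  qed
  then have "homogeneous_component cpk n = cyc_vec.span (?b ` ?J)"
    by (simp add: homogeneous_component_def)
  moreover have "cyc_vec.independent (?b ` ?J)"
  proof (rule cyc_vec.independent_if_scalars_zero)
    fix c x assume c: "(\<Sum>x\<in>?b ` ?J. scale_vec (c x) x) = 0" and "x \<in> ?b ` ?J"
    then obtain j where j: "j \<in> ?J" "x = ?b j" by blast
    have "0 = Poly_Mapping.lookup (\<Sum>i\<in>?J. scale_vec (c (?b i)) (?b i)) (C j)"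
      using c by (simp add: sum.reindex[OF b_inj])
    also have "\<dots> = (\<Sum>i\<in>?J. c (?b i) * (if C i = C j then 1 else 0))"
      by (simp add: lookup_sum lookup_scale_vec lookup_single when_def)
    also have "\<dots> = (\<Sum>i\<in>?J. if i = j then c x else 0)"
      using inj_onD[OF C_inj] j by (intro sum.cong refl) auto
    also have "\<dots> = c x" using J j(1) by simp
    finally show "c x = 0" ..
  qed (use J in simp)
  ultimately show ?thesis
    by (simp add: cyc_vec.dim_eq_card_independent card_image[OF b_inj])
qed

section \<open>The two realizations\<close>

lemma fps_one_plus_X_power_nth: "((1 + fps_X) ^ m :: rat fps) $ i = of_nat (m choose i)"
  by (simp add: fps_binomial_of_nat[symmetric] binomial_gbinomial)

lemma geom_power_nth: "geom ^ (n + 1) $ k = of_nat (multichoose (n + 1) k)"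
proof -
  have "geom ^ (n + 1) = inverse ((1 - fps_const 1 * fps_X) ^ (n + 1))"
    by (simp only: fps_const_1_eq_1 mult_1_left fps_inverse_power)
  also have "\<dots> = Abs_fps (\<lambda>k. of_nat ((n + 1 + k - 1) choose k) * 1 ^ k)"
    by (rule one_minus_const_fps_X_neg_power') simp
  finally show ?thesis by (simp add: multichoose_def card_multisets_of_size)
qed

lemma X_power_product_nth:
  "(fps_X ^ i * (geom ^ (n + 1) * (1 + fps_X) ^ m)) $ p =
     (\<Sum>k | k + i \<le> p. of_nat (multichoose (n + 1) k) * of_nat (m choose (p - i - k)))"
proof (cases "i \<le> p")
  case True
  then have "{k. k + i \<le> p} = {0..p - i}" by auto
  then show ?thesis using True
    unfolding fps_X_power_mult_nth unfolding fps_mult_nth geom_power_nth fps_one_plus_X_power_nth by simp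
next
  case False
  then have "{k. k + i \<le> p} = {}" by auto
  then show ?thesis using False by (simp only: fps_X_power_mult_nth sum.empty) simp
qed

text \<open>
  The coefficients of \<open>1 / (1 - t)^(n + 1)\<close> are multiset numbers and those of \<open>(1 + t)^m\<close> are binomial
  coefficients, so each summand of the series is a shifted Cauchy product.
\<close>
lemma w_eq_cpk_fps:
  assumes "2 * j \<le> n" "1 \<le> n"
  shows "w n j = (\<lambda>p. monom (cpk_fps n j $ p) n)"
proof
  fix p
  have c: "(of_nat a * 4 ^ j :: rat fps) = fps_const (of_nat a * 4 ^ j)" for a
    by (simp add: fps_const_power[symmetric] fps_of_nat[symmetric] numeral_fps_const fps_const_mult[symmetric]
        del: fps_const_power fps_const_mult)
  have "cpk_fps n j = fps_const (of_nat j * 4 ^ j) * (fps_X ^ j * (geom ^ (n + 1) * (1 + fps_X) ^ (n - 2 * j + 1)))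
      + fps_const (of_nat (2 * (n - 2 * j)) * 4 ^ j) *
        (fps_X ^ (j + 1) * (geom ^ (n + 1) * (1 + fps_X) ^ (n - 2 * j - 1)))"
    unfolding cpk_fps_eq[OF assms] c[symmetric] by (simp add: power_mult_distrib mult_ac)
  then have "cpk_fps n j $ p = of_nat j * 4 ^ j *
      (\<Sum>k | k + j \<le> p. of_nat (multichoose (n + 1) k) * of_nat ((n - 2 * j + 1) choose (p - j - k)))
    + of_nat (2 * (n - 2 * j)) * 4 ^ j *
      (\<Sum>k | k + (j + 1) \<le> p. of_nat (multichoose (n + 1) k) * of_nat ((n - 2 * j - 1) choose (p - (j + 1) - k)))"
    unfolding X_power_product_nth[symmetric] by simp
  moreover have "p - (j + 1) - k = p - j - k - 1" "k + (j + 1) \<le> p \<longleftrightarrow> k + 1 + j \<le> p" for k by auto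
  moreover have "of_nat (2 * (n - 2 * j)) = 2 * (of_nat n - 2 * of_nat j :: rat)"
    using assms(1) by (simp add: of_nat_diff)
  ultimately show "w n j p = monom (cpk_fps n j $ p) n" unfolding w_def by simp
qed

lemma sum_fun_apply: "(\<Sum>i\<in>I. f i) x = (\<Sum>i\<in>I. f i x)" for f :: "'a \<Rightarrow> 'b \<Rightarrow> 'c::comm_monoid_add"
  by (induction I rule: infinite_finite_induct) simp_all

lemma coeff_sum_monom:
  assumes "finite N" "n \<in> N"
  shows "coeff (\<Sum>m\<in>N. monom (a m) m) n = a n"
  using assms by (simp add: coeff_sum)

lemma graded_fps_embedding_pfun: "graded_fps_embedding scale_pfun (\<lambda>n F p. monom (F $ p) n)"
proof
  show "scale_pfun c x * y = scale_pfun c (x * y)" for c x y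
    by (simp add: scale_pfun_def fun_eq_iff)
  show "F n = 0" if N: "finite N" "(\<Sum>n\<in>N. (\<lambda>p. monom (F n $ p) n)) = 0" "n \<in> N" for N n and F :: "nat \<Rightarrow> rat fps"
  proof (rule fps_ext)
    fix p
    have "(\<Sum>n\<in>N. monom (F n $ p) n) = 0"
      using fun_cong[OF N(2), of p] by (simp add: sum_fun_apply)
    then show "F n $ p = 0 $ p" using coeff_sum_monom[OF N(1,3), of "\<lambda>n. F n $ p"] by simp
  qed
qed (auto simp: fun_eq_iff scale_pfun_def mult_monom add_monom smult_monom fps_divide_unit
    fps_inverse_one_minus_fps_X one_pCons monom_0)

lemma hfps_of_fps_arith:
  "hfps_of_fps (F + G) = hfps_of_fps F + hfps_of_fps G"
  "hfps_of_fps (fps_const c * F) = scale_hfps c (hfps_of_fps F)"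
  "hfps_of_fps F * hfps_of_fps G = hfps_of_fps (Abs_fps (\<lambda>p. F $ p * G $ p))"
  "hfps_of_fps (1 / (1 - fps_X)) = 1"
  "hfps_of_fps F = 0 \<longleftrightarrow> F = 0"
  "scale_hfps c x * y = scale_hfps c (x * y)"
proof -
  show "scale_hfps c x * y = scale_hfps c (x * y)" by transfer (simp add: fps_eq_iff)
qed (simp_all add: plus_hfps.abs_eq scale_hfps.abs_eq times_hfps.abs_eq one_hfps_def zero_hfps_def
    fps_divide_unit fps_inverse_one_minus_fps_X hfps_of_fps_inject)

lemma graded_fps_embedding_hpoly: "graded_fps_embedding scale_hpoly (\<lambda>n F. monom (hfps_of_fps F) n)"
proof
  show "scale_hpoly c x * y = scale_hpoly c (x * y)" for c x y
  proof -
    have sum: "scale_hfps c (\<Sum>i\<in>I. f i) = (\<Sum>i\<in>I. scale_hfps c (f i))" for I and f :: "nat \<Rightarrow> hfps"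
    proof -
      have "scale_hfps c 0 = 0" "scale_hfps c (a + b) = scale_hfps c a + scale_hfps c b" for a b
        by (transfer; simp add: distrib_left)+
      then show ?thesis by (induction I rule: infinite_finite_induct) simp_all
    qed
    show ?thesis
      by (simp add: poly_eq_iff coeff_scale_hpoly coeff_mult hfps_of_fps_arith(6) sum)
  qed
  show "F n = 0" if N: "finite N" "(\<Sum>n\<in>N. monom (hfps_of_fps (F n)) n) = 0" "n \<in> N" for N n and F :: "nat \<Rightarrow> rat fps"
    using coeff_sum_monom[OF N(1,3), of "\<lambda>n. hfps_of_fps (F n)"] N(2) hfps_of_fps_arith(5) by simp
  have "scale_hfps c 0 = 0" for c by transfer simp
  then show "monom (hfps_of_fps (fps_const c * F)) n = scale_hpoly c (monom (hfps_of_fps F) n)" for n c F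
    by (simp add: poly_eq_iff coeff_scale_hpoly hfps_of_fps_arith)
qed (auto simp: mult_monom add_monom hfps_of_fps_arith monom_0 one_pCons)

lemma cpk_values_cases:
  "j \<in> cpk_values n \<longleftrightarrow> n \<le> 1 \<and> j = 0 \<or> 2 \<le> n \<and> 1 \<le> j \<and> j \<le> n div 2"
  by (auto simp: cpk_values_def)

lemma Collect_cpk_values:
  assumes "\<And>n j. 2 \<le> n \<Longrightarrow> 1 \<le> j \<Longrightarrow> j \<le> n div 2 \<Longrightarrow> g n j = h n j"
  shows "{g n j |n j. j \<in> cpk_values n} = {g 0 0, g 1 0} \<union> {h n j |n j. 2 \<le> n \<and> 1 \<le> j \<and> j \<le> n div 2}"
    (is "?L = ?R")
proof
  show "?L \<subseteq> ?R"
  proof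
    fix x assume "x \<in> ?L"
    then obtain n j where x: "x = g n j" and j: "j \<in> cpk_values n" by blast
    show "x \<in> ?R"
    proof (cases "n \<le> 1")
      case True
      then have "n = 0 \<or> n = 1" "j = 0" using j by (auto simp: cpk_values_cases)
      then show ?thesis using x by auto
    next
      case False
      then have n: "2 \<le> n" "1 \<le> j" "j \<le> n div 2" using j by (auto simp: cpk_values_cases)
      then show ?thesis using x assms[OF n] by blast
    qed
  qed
  have "0 \<in> cpk_values 0" "0 \<in> cpk_values 1" by (simp_all add: cpk_values_def)
  moreover have "h n j \<in> ?L" if "2 \<le> n" "1 \<le> j" "j \<le> n div 2" for n j
  proof -
    have "j \<in> cpk_values n" using that by (simp add: cpk_values_cases)
    then have "g n j \<in> ?L" by blast
    then show ?thesis using assms[OF that] by simp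
  qed
  ultimately show "?R \<subseteq> ?L" by blast
qed

text \<open>
  The series of length 1 is \<open>2t / (1 - t)^2\<close>, twice the generator of the span.
\<close>
lemma hpoly_span:
  "hpoly.span {monom (hfps_of_fps (class_fps n j)) n |n j. j \<in> cpk_values n} =
   hpoly.span ({monom (hfps_of_fps (1 / (1 - fps_X))) 0, monom (hfps_of_fps (fps_X / (1 - fps_X) ^ 2)) 1}
     \<union> {cpk_series n j |n j. 2 \<le> n \<and> 1 \<le> j \<and> j \<le> n div 2})"
  (is "hpoly.span ?A = hpoly.span ({?e, ?t} \<union> ?B)")
proof -
  interpret graded_fps_embedding scale_hpoly "\<lambda>n F. monom (hfps_of_fps F) n"
    by (rule graded_fps_embedding_hpoly)
  have "cpk_fps 1 0 = fps_const 2 * (fps_X / (1 - fps_X) ^ 2)"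
    by (simp add: cpk_fps_def numeral_fps_const power2_eq_square fps_divide_unit mult_ac)
  then have two: "cpk_series 1 0 = scale_hpoly 2 ?t"
    unfolding cpk_series_def by (simp only: emb_scale)
  have half: "?t = scale_hpoly (1 / 2) (cpk_series 1 0)" unfolding two by simp
  have A: "?A = {?e, cpk_series 1 0} \<union> ?B"
    by (subst Collect_cpk_values[where h = cpk_series]) (simp_all add: class_fps_def cpk_series_def)
  show ?thesis
    unfolding A hpoly.span_eq
  proof
    show "{?e, cpk_series 1 0} \<union> ?B \<subseteq> hpoly.span ({?e, ?t} \<union> ?B)"
      unfolding two by (auto intro: hpoly.span_base hpoly.span_scale)
    show "{?e, ?t} \<union> ?B \<subseteq> hpoly.span ({?e, cpk_series 1 0} \<union> ?B)"
      unfolding half by (auto intro: hpoly.span_base hpoly.span_scale)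
  qed
qed

lemma pfun_class_value:
  assumes "j \<in> cpk_values n"
  shows "(\<lambda>p. monom (class_fps n j $ p) n) = (if n = 0 then 1 else w n j)"
  using assms w_eq_cpk_fps[of j n]
  by (auto simp: class_fps_def cpk_values_cases fps_divide_unit fps_inverse_one_minus_fps_X
      fun_eq_iff monom_0 one_pCons)

lemma pfun_generators:
  "{\<lambda>p. monom (class_fps n j $ p) n |n j. j \<in> cpk_values n} =
    {1, w 1 0} \<union> {w n j |n j. 2 \<le> n \<and> 1 \<le> j \<and> j \<le> n div 2}"
  by (subst Collect_cpk_values[where h = w]) (simp_all add: pfun_class_value cpk_values_cases)

theorem theorem4p9:
  shows "cyc_shuffle_compatible cpk \<and>
    (\<exists>\<phi>.
      (\<forall>\<pi>. lin_perm \<pi> \<longrightarrow>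
         \<phi> (cst_basis cpk (cyc \<pi>)) =
           (if length \<pi> \<ge> 1 then cpk_series (length \<pi>) (cpk (cyc \<pi>))
            else monom (hfps_of_fps (1 / (1 - fps_X))) 0)) \<and>
      algebra_iso (cyc_algebra cpk)
        (restricted_algebra scale_hpoly
          (hpoly.span
            ({monom (hfps_of_fps (1 / (1 - fps_X))) 0,
              monom (hfps_of_fps (fps_X / (1 - fps_X) ^ 2)) 1}
             \<union> {cpk_series n j |n j. 2 \<le> n \<and> 1 \<le> j \<and> j \<le> n div 2}))) \<phi>) \<and>
    (\<exists>\<psi>.
      (\<forall>\<pi>. lin_perm \<pi> \<longrightarrow>
         \<psi> (cst_basis cpk (cyc \<pi>)) =
           (if length \<pi> \<ge> 1 then w (length \<pi>) (cpk (cyc \<pi>)) else 1)) \<and>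
      algebra_iso (cyc_algebra cpk)
        (restricted_algebra scale_pfun
          (pfun.span ({1, w 1 0} \<union> {w n j |n j. 2 \<le> n \<and> 1 \<le> j \<and> j \<le> n div 2}))) \<psi>) \<and>
    (\<forall>n\<ge>2. cyc_vec.dim (homogeneous_component cpk n) = n div 2)"
proof (intro conjI allI impI)
  show "cyc_shuffle_compatible cpk" by (rule cyc_shuffle_compatible_cpk)
  show "cyc_vec.dim (homogeneous_component cpk n) = n div 2" if "2 \<le> n" for n
    using that by (simp add: dim_homogeneous_component_cpk cpk_values_def)
  show "\<exists>\<phi>. (\<forall>\<pi>. lin_perm \<pi> \<longrightarrow>
         \<phi> (cst_basis cpk (cyc \<pi>)) =
           (if length \<pi> \<ge> 1 then cpk_series (length \<pi>) (cpk (cyc \<pi>))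
            else monom (hfps_of_fps (1 / (1 - fps_X))) 0)) \<and>
      algebra_iso (cyc_algebra cpk)
        (restricted_algebra scale_hpoly
          (hpoly.span
            ({monom (hfps_of_fps (1 / (1 - fps_X))) 0,
              monom (hfps_of_fps (fps_X / (1 - fps_X) ^ 2)) 1}
             \<union> {cpk_series n j |n j. 2 \<le> n \<and> 1 \<le> j \<and> j \<le> n div 2}))) \<phi>"
  proof -
    obtain \<phi> where
      val: "\<And>\<pi>. lin_perm \<pi> \<Longrightarrow> \<phi> (cst_basis cpk (cyc \<pi>)) =
        monom (hfps_of_fps (class_fps (length \<pi>) (cpk (cyc \<pi>)))) (length \<pi>)"
      and iso: "algebra_iso (cyc_algebra cpk) (restricted_algebra scale_hpoly
        (hpoly.span {monom (hfps_of_fps (class_fps n j)) n |n j. j \<in> cpk_values n})) \<phi>"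
      using graded_fps_embedding.cpk_algebra_iso[OF graded_fps_embedding_hpoly] by blast
    show ?thesis
      using iso unfolding hpoly_span
      by (intro exI[of _ \<phi>] conjI) (auto simp: val class_fps_def cpk_series_def Suc_le_eq)
  qed
  show "\<exists>\<psi>. (\<forall>\<pi>. lin_perm \<pi> \<longrightarrow>
         \<psi> (cst_basis cpk (cyc \<pi>)) =
           (if length \<pi> \<ge> 1 then w (length \<pi>) (cpk (cyc \<pi>)) else 1)) \<and>
      algebra_iso (cyc_algebra cpk)
        (restricted_algebra scale_pfun
          (pfun.span ({1, w 1 0} \<union> {w n j |n j. 2 \<le> n \<and> 1 \<le> j \<and> j \<le> n div 2}))) \<psi>"
  proof -
    obtain \<psi> where
      val: "\<And>\<pi>. lin_perm \<pi> \<Longrightarrow> \<psi> (cst_basis cpk (cyc \<pi>)) =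
        (\<lambda>p. monom (class_fps (length \<pi>) (cpk (cyc \<pi>)) $ p) (length \<pi>))"
      and iso: "algebra_iso (cyc_algebra cpk) (restricted_algebra scale_pfun
        (pfun.span {\<lambda>p. monom (class_fps n j $ p) n |n j. j \<in> cpk_values n})) \<psi>"
      using graded_fps_embedding.cpk_algebra_iso[OF graded_fps_embedding_pfun] by blast
    show ?thesis
      using iso unfolding pfun_generators
      by (intro exI[of _ \<psi>] conjI) (auto simp: val pfun_class_value[OF cpk_in_values] Suc_le_eq)
  qed
qed

end
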